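(* Let $q=5$, $A=\mathbb{F}_5[T]$, $k=\mathbb{F}_5(T)$. For $D=2T^2+1$, $D=2T^2+3$, and $D=2T^2+4$, the norm of a Drinfeld singular modulus $j$ with discriminant $D$ is equal to $3(T+1)^{12}(T+4)^{12}$, $4T^{12}(T+1)^6(T+4)^6$, and $2(T+2)^{12}(T+3)^{12}$ respectively. In particular, the norm of $j$ is not monic in any of these cases.
   Context: Let $k_\infty=\mathbb{F}_q((1/T))$ with $q=5$ and let $\mathbb{C}_\infty$ be the completion of an algebraic closure of $k_\infty$. Let $\mathbb{C}_\infty\{\tau\}$ be the ring of twisted polynomials, with $\tau c=c^q\tau$ for $c\in\mathbb{C}_\infty$. A Drinfeld $A$-module $\Phi$ of rank $2$ over $\mathbb{C}_\infty$ is given by $\Phi_T=T+g\tau+\Delta\tau^2\in\mathbb{C}_\infty\{\tau\}$ with $\Delta\neq0$. Its endomorphism ring is $\mathrm{End}_{\mathbb{C}_\infty}(\Phi)=\{u\in\mathbb{C}_\infty\{\tau\}\mid u\Phi_T=\Phi_Tu\}$, identified with a subring of $\mathbb{C}_\infty$ containing $A$ by taking constant coefficients. Its $j$-invariant is $j(\Phi)=g^{q+1}/\Delta$. A Drinfeld singular modulus is an element $j(\Phi)$ with $\mathrm{End}_{\mathbb{C}_\infty}(\Phi)\neq A$; it is said to have discriminant $D\in A$ if $\mathrm{End}_{\mathbb{C}_\infty}(\Phi)=A[\sqrt D]=A+A\sqrt D$. Drinfeld singular moduli are integral over $A$. The norm of $j$ is $N_{k(j)/k}(j)\in A$. *)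

theory Defs
  imports
    Complex_Main
    "HOL-Library.FuncSet"
    "HOL-Library.Cardinality"
    "HOL-Computational_Algebra.Formal_Laurent_Series"
    "Jordan_Normal_Form.Determinant"
begin

section \<open>The field of constants, the place at infinity and its completions\<close>

text \<open>
  Throughout, \<open>'a\<close> is the finite field with \<open>q = CARD('a)\<close> elements and \<open>A = 'a poly\<close>.
  The completion of \<open>k = Frac A\<close> at infinity is \<open>'a fls\<close>, whose formal variable stands
  for \<open>1/T\<close>; hence \<open>T\<close> is \<open>fls_X_inv\<close>.
\<close>

abbreviation poly_T :: "'a::field poly" where
  "poly_T \<equiv> [:0, 1:]"

definition fls_of_poly :: "'a::field poly \<Rightarrow> 'a fls" where
  "fls_of_poly p = poly (map_poly fls_const p) fls_X_inv"

lemma fls_of_poly_T: "fls_of_poly poly_T = fls_X_inv"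
  by (simp add: fls_of_poly_def map_poly_pCons)

text \<open>Normalised by \<open>|T| = q\<close>.\<close>

definition abs_infinity :: "'a::{finite,field} fls \<Rightarrow> real" where
  "abs_infinity f = (if f = 0 then 0 else real CARD('a) powi (- fls_subdegree f))"

definition algebraic_elements :: "('k::field \<Rightarrow> 'c::field) \<Rightarrow> 'c set" where
  "algebraic_elements \<iota> = {x. \<exists>p. p \<noteq> 0 \<and> poly (map_poly \<iota> p) x = 0}"

text \<open>
  The field \<open>'c\<close>, together with \<open>\<iota>\<close>, is a completion of an algebraic closure of
  \<open>'a fls\<close>: the metric comes from the absolute value \<open>x \<mapsto> dist x 0\<close>, which
  extends the one of \<open>'a fls\<close>; \<open>'c\<close> is complete (by its type class); and the elements of
  \<open>'c\<close> that are algebraic over \<open>'a fls\<close> are dense and form an algebraically closed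
  field. This determines \<open>'c\<close> up to an isometric isomorphism over \<open>'a fls\<close>.
\<close>

locale completed_algebraic_closure = field_hom \<iota>
  for \<iota> :: "'a::{finite,field} fls \<Rightarrow> 'c::{field,complete_space}" +
  assumes dist_translate: "dist (x + z) (y + z) = dist x (y :: 'c)"
    and dist_mult: "dist (x * y) 0 = dist x 0 * dist y (0 :: 'c)"
    and dist_extends: "dist (\<iota> f) 0 = abs_infinity f"
    and algebraic_elements_closed:
      "degree p > 0 \<Longrightarrow> (\<forall>i. coeff p i \<in> algebraic_elements \<iota>) \<Longrightarrow>
        \<exists>x\<in>algebraic_elements \<iota>. poly p x = 0"
    and algebraic_elements_dense: "e > 0 \<Longrightarrow> \<exists>y\<in>algebraic_elements \<iota>. dist x y < e"

definition emb_A :: "('a::field fls \<Rightarrow> 'c::field) \<Rightarrow> 'a poly \<Rightarrow> 'c" where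
  "emb_A \<iota> a = \<iota> (fls_of_poly a)"

definition field_k :: "('a::field fls \<Rightarrow> 'c::field) \<Rightarrow> 'c set" where
  "field_k \<iota> = {emb_A \<iota> a / emb_A \<iota> b | a b. b \<noteq> 0}"


section \<open>Twisted polynomials and Drinfeld modules of rank two\<close>

text \<open>
  A twisted polynomial \<open>\<Sum>i. u\<^sub>i \<tau>\<^sup>i\<close> is represented by the
  ordinary polynomial with coefficients \<open>u\<^sub>i\<close>. Addition is that of polynomials, and the
  multiplication is the one below, determined by \<open>\<tau> c = c\<^sup>q \<tau>\<close>.
\<close>

definition twisted_mult :: "nat \<Rightarrow> 'c::field poly \<Rightarrow> 'c poly \<Rightarrow> 'c poly" where
  "twisted_mult q u v =
    (\<Sum>i\<le>degree u. \<Sum>j\<le>degree v. monom (coeff u i * coeff v j ^ (q ^ i)) (i + j))"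

lemma twisted_mult_tau_const:
  "twisted_mult q (monom 1 1) [:c:] = twisted_mult q [:c ^ q:] (monom 1 1)"
  by (simp add: twisted_mult_def degree_monom_eq)

definition drinfeld_T :: "('a::{finite,field} fls \<Rightarrow> 'c::field) \<Rightarrow> 'c \<Rightarrow> 'c \<Rightarrow> 'c poly" where
  "drinfeld_T \<iota> g \<Delta> = [:emb_A \<iota> poly_T, g, \<Delta>:]"

definition drinfeld_j :: "nat \<Rightarrow> 'c::field \<Rightarrow> 'c \<Rightarrow> 'c" where
  "drinfeld_j q g \<Delta> = g ^ (q + 1) / \<Delta>"

definition drinfeld_End :: "('a::{finite,field} fls \<Rightarrow> 'c::field) \<Rightarrow> 'c \<Rightarrow> 'c \<Rightarrow> 'c poly set" where
  "drinfeld_End \<iota> g \<Delta> =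
    {u. twisted_mult CARD('a) u (drinfeld_T \<iota> g \<Delta>) = twisted_mult CARD('a) (drinfeld_T \<iota> g \<Delta>) u}"

text \<open>The endomorphism ring as a subring of \<open>'c\<close>, by taking constant coefficients.\<close>

definition drinfeld_End_const :: "('a::{finite,field} fls \<Rightarrow> 'c::field) \<Rightarrow> 'c \<Rightarrow> 'c \<Rightarrow> 'c set" where
  "drinfeld_End_const \<iota> g \<Delta> = (\<lambda>u. coeff u 0) ` drinfeld_End \<iota> g \<Delta>"

definition singular_modulus_with_discriminant ::
    "('a::{finite,field} fls \<Rightarrow> 'c::field) \<Rightarrow> 'a poly \<Rightarrow> 'c \<Rightarrow> bool" where
  "singular_modulus_with_discriminant \<iota> D j \<longleftrightarrow>
    (\<exists>g \<Delta>. \<Delta> \<noteq> 0 \<and> j = drinfeld_j CARD('a) g \<Delta> \<and>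
       drinfeld_End_const \<iota> g \<Delta> \<noteq> range (emb_A \<iota>) \<and>
       (\<exists>s. s\<^sup>2 = emb_A \<iota> D \<and>
            drinfeld_End_const \<iota> g \<Delta> = {emb_A \<iota> a + emb_A \<iota> b * s | a b. True}))"


section \<open>Norms of field extensions\<close>

definition is_subfield :: "'c::field set \<Rightarrow> bool" where
  "is_subfield L \<longleftrightarrow> 0 \<in> L \<and> 1 \<in> L \<and>
    (\<forall>x\<in>L. \<forall>y\<in>L. x - y \<in> L \<and> x * y \<in> L) \<and> (\<forall>x\<in>L. inverse x \<in> L)"

definition adjoin :: "'c::field set \<Rightarrow> 'c \<Rightarrow> 'c set" where
  "adjoin K x = is_subfield hull (insert x K)"

definition is_basis_over :: "'c::field set \<Rightarrow> 'c set \<Rightarrow> nat \<Rightarrow> (nat \<Rightarrow> 'c) \<Rightarrow> bool" where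
  "is_basis_over K L n b \<longleftrightarrow> (\<forall>i<n. b i \<in> L) \<and>
    (\<forall>x\<in>L. \<exists>!c. c \<in> {..<n} \<rightarrow>\<^sub>E K \<and> x = (\<Sum>i<n. c i * b i))"

text \<open>
  The norm of \<open>x \<in> L\<close> over \<open>K\<close>: the determinant of multiplication by \<open>x\<close> on the
  finite-dimensional \<open>K\<close>-vector space \<open>L\<close>, with respect to any basis. It is unspecified
  when \<open>L\<close> is not finite over \<open>K\<close>.
\<close>

definition field_norm :: "'c::field set \<Rightarrow> 'c set \<Rightarrow> 'c \<Rightarrow> 'c" where
  "field_norm K L x = (THE y. \<exists>n b M. is_basis_over K L n b \<and>
     M \<in> carrier_mat n n \<and> (\<forall>i<n. \<forall>l<n. M $$ (i, l) \<in> K) \<and>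
     (\<forall>i<n. x * b i = (\<Sum>l<n. M $$ (i, l) * b l)) \<and> y = det M)"

definition norm_over_k :: "('a::field fls \<Rightarrow> 'c::field) \<Rightarrow> 'c \<Rightarrow> 'c" where
  "norm_over_k \<iota> j = field_norm (field_k \<iota>) (adjoin (field_k \<iota>) j) j"

end

theory Submission
  imports Defs
begin

text \<open>
  Let \<open>j\<close> be the \<open>j\<close>-invariant of \<open>\<Phi>\<^sub>T = T + g \<tau> + \<Delta> \<tau>\<^sup>2\<close> whose endomorphism ring contains a square
  root \<open>s\<close> of \<open>D = 2 T\<^sup>2 + c\<close>. The proof computes \<open>j\<close> explicitly, without class field theory or
  reduction of Drinfeld modules, because \<open>D\<close> has small degree. Endomorphisms
  are determined by their constant coefficient (\<open>twisted_commutant_eq_0\<close>), so the endomorphism \<open>u\<close>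
  belonging to \<open>s\<close> satisfies \<open>u\<^sup>2 = \<Phi>\<^sub>D\<close>, which has degree \<open>4\<close> in \<open>\<tau>\<close>; therefore
  \<open>u = s + a \<tau> + b \<tau>\<^sup>2\<close>, and comparing leading coefficients makes \<open>b / \<Delta>\<close> a square root of \<open>2\<close>
  (\<open>endomorphism_sqrt_discriminant\<close>).

  The coefficients of \<open>\<tau>\<close> and \<open>\<tau>\<^sup>2\<close> in \<open>u \<Phi>\<^sub>T = \<Phi>\<^sub>T u\<close> determine \<open>a\<close>, and then express \<open>b / \<Delta>\<close> as a
  linear function of \<open>j\<close> with coefficients in \<open>k s\<close>. Solving for \<open>j\<close> puts it in
  \<open>k(w)\<close> with \<open>w = b s / \<Delta>\<close> and \<open>w\<^sup>2 = 2 D\<close>. As \<open>2 D = (2 T)\<^sup>2 + 2 c\<close> has no square root in \<open>k\<close>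
  (\<open>no_rational_sqrt_square_plus_const\<close>), this is a quadratic field and \<open>j = x + y w\<close> has norm
  \<open>x\<^sup>2 - 2 D y\<^sup>2\<close> (\<open>field_norm_quadratic\<close>, \<open>norm_of_singular_modulus\<close>). Which of the two square roots
  of \<open>2\<close> occurs only exchanges \<open>j\<close> with its conjugate.

  What remains is, for each of the three \<open>D\<close>, one identity between polynomials with coefficients modulo
  \<open>5\<close> (\<open>norm_identity_1\<close>, \<open>norm_identity_3\<close>, \<open>norm_identity_4\<close>). All of them are even in \<open>T\<close>, so
  they are proved in the variable \<open>y = T\<^sup>2\<close>.
\<close>

section \<open>The ring of twisted polynomials\<close>

lemma sum_eq_single:
  assumes "finite A" "a \<in> A" "\<And>i. i \<in> A \<Longrightarrow> i \<noteq> a \<Longrightarrow> f i = 0"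
  shows "sum f A = f a"
  using assms by (simp add: sum.remove[of A a])

lemma coeff_twisted_mult:
  assumes "q > 0"
  shows "coeff (twisted_mult q u v) n = (\<Sum>i=0..n. coeff u i * coeff v (n - i) ^ (q ^ i))"
proof -
  let ?f = "\<lambda>i. coeff u i * coeff v (n - i) ^ (q ^ i)"
  have inner: "(\<Sum>j\<le>degree v. coeff (monom (coeff u i * coeff v j ^ (q ^ i)) (i + j)) n)
      = (if i \<le> n then ?f i else 0)" for i
  proof (cases "i \<le> n")
    case True
    then have "(\<Sum>j\<le>degree v. coeff (monom (coeff u i * coeff v j ^ (q ^ i)) (i + j)) n)
        = (\<Sum>j\<le>degree v. if j = n - i then coeff u i * coeff v j ^ (q ^ i) else 0)"
      by (intro sum.cong) auto
    also have "\<dots> = ?f i"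
      using assms by (auto simp: sum.delta coeff_eq_0 power_0_left)
    finally show ?thesis using True by simp
  qed auto
  have "coeff (twisted_mult q u v) n = (\<Sum>i\<le>degree u. if i \<le> n then ?f i else 0)"
    unfolding twisted_mult_def coeff_sum inner ..
  also have "\<dots> = (\<Sum>i\<in>{..degree u} \<inter> {..n}. ?f i)"
    by (simp add: sum.If_cases atMost_def Int_def)
  also have "\<dots> = (\<Sum>i=0..n. ?f i)"
    by (intro sum.mono_neutral_left) (auto simp: coeff_eq_0)
  finally show ?thesis .
qed

text \<open>
  Twisted polynomials form a domain whose degree is additive, as for ordinary polynomials: only
  one pair of coefficients meets in the top degree.
\<close>

lemma coeff_twisted_mult_top:
  assumes "q > 0"
  shows "coeff (twisted_mult q u v) (degree u + degree v) =
    lead_coeff u * lead_coeff v ^ (q ^ degree u)"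
proof -
  have "coeff u i * coeff v (degree u + degree v - i) ^ (q ^ i) = 0" if "i \<noteq> degree u" for i
  proof (cases "i < degree u")
    case True
    then have "coeff v (degree u + degree v - i) = 0" by (intro coeff_eq_0) simp
    then show ?thesis using assms by (simp add: power_0_left)
  qed (use that in \<open>auto simp: coeff_eq_0\<close>)
  then show ?thesis
    unfolding coeff_twisted_mult[OF assms] by (subst sum_eq_single[of _ "degree u"]) simp_all
qed

lemma degree_twisted_mult:
  assumes "q > 0" "u \<noteq> 0" "v \<noteq> 0"
  shows "degree (twisted_mult q u v) = degree u + degree v"
proof (rule antisym)
  show "degree (twisted_mult q u v) \<le> degree u + degree v"
  proof (rule degree_le, intro allI impI)
    fix n assume n: "degree u + degree v < n"
    have "coeff u i * coeff v (n - i) ^ (q ^ i) = 0" for i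
      using n assms(1)
      by (cases "i \<le> degree u") (auto simp: coeff_eq_0 power_0_left)
    then show "coeff (twisted_mult q u v) n = 0"
      unfolding coeff_twisted_mult[OF assms(1)] by (intro sum.neutral) blast
  qed
  have "coeff (twisted_mult q u v) (degree u + degree v) \<noteq> 0"
    using assms by (simp add: coeff_twisted_mult_top)
  then show "degree u + degree v \<le> degree (twisted_mult q u v)" by (rule le_degree)
qed

text \<open>
  The powers \<open>x \<mapsto> x ^ (q ^ i)\<close> are additive when \<open>q\<close> is a power of the characteristic.
  This is all that is needed to make \<open>twisted_mult q\<close> associative and distributive.
\<close>

context
  fixes q :: nat
  assumes q_pos: "q > 0"
    and frob_add: "\<And>x y :: 'c::field. (x + y) ^ q = x ^ q + y ^ q"
begin

lemma frob_power_add: "((x::'c) + y) ^ (q ^ i) = x ^ (q ^ i) + y ^ (q ^ i)"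
  by (induction i arbitrary: x y) (simp_all add: power_mult frob_add)

lemma frob_power_diff: "((x::'c) - y) ^ (q ^ i) = x ^ (q ^ i) - y ^ (q ^ i)"
  using frob_power_add[of "x - y" y i] by (simp add: algebra_simps)

lemma frob_power_sum: "(\<Sum>a\<in>B. f a :: 'c) ^ (q ^ i) = (\<Sum>a\<in>B. f a ^ (q ^ i))"
  using q_pos by (induction B rule: infinite_finite_induct) (simp_all add: frob_power_add power_0_left)

lemma twisted_mult_assoc:
  "twisted_mult q (twisted_mult q u v) w = twisted_mult q u (twisted_mult q v (w :: 'c poly))"
proof (rule poly_eqI)
  fix n
  note c = coeff_twisted_mult[OF q_pos]
  have "coeff (twisted_mult q (twisted_mult q u v) w) n =
      (\<Sum>k=0..n. \<Sum>i=0..k. coeff u i * coeff v (k - i) ^ (q ^ i)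
         * coeff w (n - k) ^ (q ^ (i + (k - i))))"
    by (simp add: c sum_distrib_right)
  also have "\<dots> = (\<Sum>k=0..n. \<Sum>i=0..n - k. coeff u k * coeff v i ^ (q ^ k)
         * coeff w (n - k - i) ^ (q ^ (k + i)))"
    by (rule fps_mult_assoc_lemma)
  also have "\<dots> = coeff (twisted_mult q u (twisted_mult q v w)) n"
    by (simp add: c frob_power_sum sum_distrib_left power_mult_distrib power_add power_mult
        mult_ac flip: power_mult)
  finally show "coeff (twisted_mult q (twisted_mult q u v) w) n = \<dots>" .
qed

lemma twisted_mult_add_right:
  "twisted_mult q u (v + w :: 'c poly) = twisted_mult q u v + twisted_mult q u w"
  by (rule poly_eqI) (simp add: coeff_twisted_mult[OF q_pos] frob_power_add sum.distrib ring_distribs)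

lemma twisted_mult_diff_right:
  "twisted_mult q u (v - w :: 'c poly) = twisted_mult q u v - twisted_mult q u w"
  by (rule poly_eqI)
    (simp add: coeff_twisted_mult[OF q_pos] frob_power_diff sum_subtractf ring_distribs)

lemma twisted_mult_diff_left:
  "twisted_mult q (u - v) (w :: 'c poly) = twisted_mult q u w - twisted_mult q v w"
  by (rule poly_eqI) (simp add: coeff_twisted_mult[OF q_pos] sum_subtractf ring_distribs)

lemma twisted_mult_add_left:
  "twisted_mult q (u + v) (w :: 'c poly) = twisted_mult q u w + twisted_mult q v w"
  by (rule poly_eqI) (simp add: coeff_twisted_mult[OF q_pos] sum.distrib ring_distribs)

lemma twisted_mult_smult_left:
  "twisted_mult q (Polynomial.smult c u) v = Polynomial.smult c (twisted_mult q u (v :: 'c poly))"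
  by (rule poly_eqI) (simp add: coeff_twisted_mult[OF q_pos] sum_distrib_left mult_ac)

lemma frob_power_fixed: "(c::'c) ^ q = c \<Longrightarrow> c ^ (q ^ i) = c"
  by (induction i) (simp_all add: power_mult)

text \<open>
  The constants fixed by the \<open>q\<close>-power map are central.
\<close>

lemma twisted_mult_smult_right:
  assumes "c ^ q = (c :: 'c)"
  shows "twisted_mult q u (Polynomial.smult c v) = Polynomial.smult c (twisted_mult q u v)"
  by (rule poly_eqI) (simp add: coeff_twisted_mult[OF q_pos] sum_distrib_left mult_ac
      power_mult_distrib frob_power_fixed[OF assms])

lemma twisted_mult_const_left: "twisted_mult q [:c:] v = Polynomial.smult c (v :: 'c poly)"
proof (rule poly_eqI)
  fix n
  have "coeff [:c:] i * coeff v (n - i) ^ (q ^ i) = 0" if "i \<noteq> 0" for i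
    using that by (simp add: coeff_pCons split: nat.splits)
  then show "coeff (twisted_mult q [:c:] v) n = coeff (Polynomial.smult c v) n"
    unfolding coeff_twisted_mult[OF q_pos] by (subst sum_eq_single[of _ 0]) simp_all
qed

lemma twisted_mult_const_right:
  assumes "c ^ q = (c :: 'c)"
  shows "twisted_mult q v [:c:] = Polynomial.smult c v"
proof (rule poly_eqI)
  fix n
  have "coeff v i * coeff [:c:] (n - i) ^ (q ^ i) = 0" if "i \<le> n" "i \<noteq> n" for i
    using that q_pos by (auto simp: coeff_pCons power_0_left split: nat.splits)
  then show "coeff (twisted_mult q v [:c:]) n = coeff (Polynomial.smult c v) n"
    unfolding coeff_twisted_mult[OF q_pos]
    by (subst sum_eq_single[of _ n]) (simp_all add: frob_power_fixed[OF assms])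
qed

text \<open>
  An endomorphism is determined by its constant coefficient. If the first nonzero coefficient of
  \<open>u\<close> were \<open>u\<^sub>n\<close> with \<open>n > 0\<close>, then comparing the coefficients of \<open>\<tau>\<^sup>n\<close> would give
  \<open>u\<^sub>n t ^ (q ^ n) = t u\<^sub>n\<close>, where \<open>t\<close> is the constant coefficient of \<open>\<Phi>\<close>;
  this is impossible when \<open>t\<close> lies in no finite extension of the field of \<open>q\<close> elements.
\<close>

lemma twisted_commutant_eq_0:
  fixes u \<Phi> :: "'c poly"
  assumes comm: "twisted_mult q u \<Phi> = twisted_mult q \<Phi> u"
    and generic: "\<And>n. n > 0 \<Longrightarrow> coeff \<Phi> 0 ^ (q ^ n) \<noteq> coeff \<Phi> 0"
    and "coeff u 0 = 0"
  shows "u = 0"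
proof (rule poly_eqI)
  fix n
  show "coeff u n = coeff 0 n"
  proof (induction n rule: less_induct)
    case (less n)
    show ?case
    proof (cases "n = 0")
      case True
      then show ?thesis using \<open>coeff u 0 = 0\<close> by simp
    next
      case False
      have "coeff (twisted_mult q u \<Phi>) n = coeff u n * coeff \<Phi> 0 ^ (q ^ n)"
        unfolding coeff_twisted_mult[OF q_pos]
        by (subst sum_eq_single[of _ n]) (use less in auto)
      moreover have "coeff (twisted_mult q \<Phi> u) n = coeff \<Phi> 0 * coeff u n"
        unfolding coeff_twisted_mult[OF q_pos]
        by (subst sum_eq_single[of _ 0]) (use less q_pos in \<open>auto simp: power_0_left\<close>)
      ultimately have "coeff u n * coeff \<Phi> 0 ^ (q ^ n) = coeff \<Phi> 0 * coeff u n"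
        using comm by metis
      then have "coeff u n * (coeff \<Phi> 0 ^ (q ^ n) - coeff \<Phi> 0) = 0"
        by (simp only: right_diff_distrib mult.commute diff_self)
      then show ?thesis using generic[of n] False by (metis eq_iff_diff_eq_0 mult_eq_0_iff gr0I coeff_0)
    qed
  qed
qed

end

section \<open>Norms from quadratic extensions\<close>

lemma is_subfield_minus: "is_subfield K \<Longrightarrow> x \<in> K \<Longrightarrow> y \<in> K \<Longrightarrow> x - y \<in> K"
  by (simp add: is_subfield_def)

lemma is_subfield_0: "is_subfield K \<Longrightarrow> 0 \<in> K"
  by (simp add: is_subfield_def)

lemma is_subfield_1: "is_subfield K \<Longrightarrow> 1 \<in> K"
  by (simp add: is_subfield_def)

lemma is_subfield_uminus: "is_subfield K \<Longrightarrow> x \<in> K \<Longrightarrow> - x \<in> K"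
  using is_subfield_minus[of K 0 x] by (simp add: is_subfield_0)

lemma is_subfield_add: "is_subfield K \<Longrightarrow> x \<in> K \<Longrightarrow> y \<in> K \<Longrightarrow> x + y \<in> K"
  using is_subfield_minus[of K x "- y"] by (simp add: is_subfield_uminus)

lemma is_subfield_mult: "is_subfield K \<Longrightarrow> x \<in> K \<Longrightarrow> y \<in> K \<Longrightarrow> x * y \<in> K"
  by (simp add: is_subfield_def)

lemma is_subfield_inverse: "is_subfield K \<Longrightarrow> x \<in> K \<Longrightarrow> inverse x \<in> K"
  by (simp add: is_subfield_def)

lemma is_subfield_divide: "is_subfield K \<Longrightarrow> x \<in> K \<Longrightarrow> y \<in> K \<Longrightarrow> x / y \<in> K"
  by (simp add: divide_inverse is_subfield_mult is_subfield_inverse)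

lemma is_subfield_sum: "is_subfield K \<Longrightarrow> (\<And>i. i \<in> I \<Longrightarrow> f i \<in> K) \<Longrightarrow> sum f I \<in> K"
  by (induction I rule: infinite_finite_induct) (auto simp: is_subfield_0 is_subfield_add)

lemmas is_subfield_closed = is_subfield_minus is_subfield_0 is_subfield_1 is_subfield_uminus
  is_subfield_add is_subfield_mult is_subfield_inverse is_subfield_divide is_subfield_sum

text \<open>
  Invariance of dimension in matrix form: if \<open>n > m\<close>, padding the factors with zeros to square
  matrices would exhibit the identity as a product whose left factor has a zero column.
\<close>

lemma right_inverse_mat_imp_le:
  fixes P Q :: "'c::field mat"
  assumes P: "P \<in> carrier_mat n m" and Q: "Q \<in> carrier_mat m n" and PQ: "P * Q = 1\<^sub>m n"
  shows "n \<le> m"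
proof (rule ccontr)
  assume "\<not> n \<le> m"
  then have mn: "m < n" by simp
  define P' where "P' = mat n n (\<lambda>(i, j). if j < m then P $$ (i, j) else 0)"
  define Q' where "Q' = mat n n (\<lambda>(i, j). if i < m then Q $$ (i, j) else 0)"
  have "P' * Q' = 1\<^sub>m n"
  proof (rule eq_matI)
    fix i j assume "i < dim_row (1\<^sub>m n :: 'c mat)" "j < dim_col (1\<^sub>m n :: 'c mat)"
    then have ij: "i < n" "j < n" by auto
    have "(P' * Q') $$ (i, j) = (\<Sum>l<n. if l < m then P $$ (i, l) * Q $$ (l, j) else 0)"
      using ij by (auto simp: P'_def Q'_def scalar_prod_def atLeast0LessThan intro!: sum.cong)
    also have "\<dots> = (\<Sum>l<m. P $$ (i, l) * Q $$ (l, j))"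
      using mn by (intro sum.mono_neutral_cong_right) auto
    also have "\<dots> = (P * Q) $$ (i, j)"
      using ij P Q by (auto simp: scalar_prod_def atLeast0LessThan intro!: sum.cong)
    finally show "(P' * Q') $$ (i, j) = 1\<^sub>m n $$ (i, j)" using PQ by simp
  qed (auto simp: P'_def Q'_def)
  then have "det P' * det Q' = 1"
    using det_mult[of P' n Q'] by (simp add: P'_def Q'_def)
  moreover from mn have "\<not> n - 1 < m" "n - 1 < n" by simp_all
  then have "det P' = 0"
    by (subst laplace_expansion_column[of P' n "n - 1"]) (auto simp: P'_def)
  ultimately show False by simp
qed

lemma det_carrier_mat_2:
  assumes "A \<in> carrier_mat 2 2"
  shows "det A = A $$ (0, 0) * A $$ (1, 1) - A $$ (0, 1) * A $$ (1, 0)"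
  using assms by (subst laplace_expansion_row[of A 2 0])
    (auto simp: cofactor_def mat_delete_def det_single numeral_2_eq_2)

text \<open>
  The next lemmas show that the determinant in the definition of the norm does not depend on the
  basis: transition matrices between two bases are mutually inverse, so the bases have
  the same length and the two matrices of multiplication by \<open>x\<close> are conjugate.
\<close>

lemma basis_coeffs_unique:
  assumes "is_basis_over K L n b" "x \<in> L" "\<And>i. i < n \<Longrightarrow> c i \<in> K" "\<And>i. i < n \<Longrightarrow> d i \<in> K"
    and "x = (\<Sum>i<n. c i * b i)" "x = (\<Sum>i<n. d i * b i)" "i < n"
  shows "c i = d i"
proof -
  have "restrict c {..<n} = restrict d {..<n}"
  proof -
    let ?Q = "\<lambda>c. c \<in> {..<n} \<rightarrow>\<^sub>E K \<and> x = (\<Sum>i<n. c i * b i)"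
    have "\<exists>!c. ?Q c"
      using assms(1,2) by (simp add: is_basis_over_def)
    moreover have "?Q (restrict c {..<n})" "?Q (restrict d {..<n})"
      using assms(3-6) by auto
    ultimately show ?thesis by blast
  qed
  then show ?thesis by (metis assms(7) lessThan_iff restrict_apply')
qed

lemma basis_change_inverse:
  assumes K: "is_subfield K" and b: "is_basis_over K L n b" and P: "P \<in> carrier_mat n m"
    and Q: "Q \<in> carrier_mat m n" 
    and PK: "\<And>i l. i < n \<Longrightarrow> l < m \<Longrightarrow> P $$ (i, l) \<in> K"
    and QK: "\<And>i l. i < m \<Longrightarrow> l < n \<Longrightarrow> Q $$ (i, l) \<in> K"
    and bP: "\<And>i. i < n \<Longrightarrow> b i = (\<Sum>l<m. P $$ (i, l) * e l)"
    and eQ: "\<And>l. l < m \<Longrightarrow> e l = (\<Sum>i<n. Q $$ (l, i) * b i)"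
  shows "P * Q = 1\<^sub>m n"
proof (rule eq_matI)
  fix i j assume "i < dim_row (1\<^sub>m n :: 'a mat)" "j < dim_col (1\<^sub>m n :: 'a mat)"
  then have ij: "i < n" "j < n" by auto
  have PQ: "(P * Q) $$ (i, j) = (\<Sum>l<m. P $$ (i, l) * Q $$ (l, j))" if "j < n" for j
    using ij that P Q by (auto simp: scalar_prod_def atLeast0LessThan intro!: sum.cong)
  have "b i = (\<Sum>l<m. P $$ (i, l) * (\<Sum>j<n. Q $$ (l, j) * b j))"
    using ij by (simp add: bP eQ)
  also have "\<dots> = (\<Sum>j<n. \<Sum>l<m. P $$ (i, l) * Q $$ (l, j) * b j)"
    by (subst sum.swap) (simp add: sum_distrib_left mult.assoc)
  also have "\<dots> = (\<Sum>j<n. (P * Q) $$ (i, j) * b j)"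
    by (simp add: PQ sum_distrib_right)
  finally have 1: "b i = \<dots>" .
  have 2: "b i = (\<Sum>j<n. (1\<^sub>m n) $$ (i, j) * b j)"
    using ij by (simp add: one_mat_def if_distrib[of "\<lambda>x. x * _"] cong: if_cong)
  have bL: "b i \<in> L" using b ij by (simp add: is_basis_over_def)
  have 3: "(P * Q) $$ (i, j) \<in> K" if "j < n" for j
    unfolding PQ[OF that] using ij that
    by (intro is_subfield_sum[OF K] is_subfield_mult[OF K] PK QK) auto
  have 4: "(1\<^sub>m n :: 'a mat) $$ (i, j) \<in> K" if "j < n" for j
    using ij that by (simp add: is_subfield_0[OF K] is_subfield_1[OF K])
  show "(P * Q) $$ (i, j) = 1\<^sub>m n $$ (i, j)"
    by (rule basis_coeffs_unique[OF b bL, where c = "\<lambda>j. (P * Q) $$ (i, j)"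
          and d = "\<lambda>j. 1\<^sub>m n $$ (i, j)", OF 3 4 1 2 ij(2)])
qed (use P Q in auto)

lemma basis_matrix_intertwine:
  assumes K: "is_subfield K" and e: "is_basis_over K L n e"
    and M: "M \<in> carrier_mat n n" "\<And>i l. i < n \<Longrightarrow> l < n \<Longrightarrow> M $$ (i, l) \<in> K"
    and bM: "\<And>i. i < n \<Longrightarrow> x * b i = (\<Sum>l<n. M $$ (i, l) * b l)"
    and N: "N \<in> carrier_mat n n" "\<And>i l. i < n \<Longrightarrow> l < n \<Longrightarrow> N $$ (i, l) \<in> K"
    and eN: "\<And>i. i < n \<Longrightarrow> x * e i = (\<Sum>l<n. N $$ (i, l) * e l)"
    and P: "P \<in> carrier_mat n n" "\<And>i l. i < n \<Longrightarrow> l < n \<Longrightarrow> P $$ (i, l) \<in> K"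
    and bP: "\<And>i. i < n \<Longrightarrow> b i = (\<Sum>l<n. P $$ (i, l) * e l)"
    and xb: "\<And>i. i < n \<Longrightarrow> x * b i \<in> L"
  shows "M * P = P * N"
proof (rule eq_matI)
  fix i j assume "i < dim_row (P * N)" "j < dim_col (P * N)"
  then have ij: "i < n" "j < n" using P N by auto
  have MP: "(M * P) $$ (i, j) = (\<Sum>l<n. M $$ (i, l) * P $$ (l, j))" if "j < n" for j
    using ij that P M by (auto simp: scalar_prod_def atLeast0LessThan intro!: sum.cong)
  have PN: "(P * N) $$ (i, j) = (\<Sum>l<n. P $$ (i, l) * N $$ (l, j))" if "j < n" for j
    using ij that P N by (auto simp: scalar_prod_def atLeast0LessThan intro!: sum.cong)
  have "x * b i = (\<Sum>l<n. M $$ (i, l) * (\<Sum>j<n. P $$ (l, j) * e j))"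
    using ij by (simp add: bM flip: bP)
  also have "\<dots> = (\<Sum>j<n. \<Sum>l<n. M $$ (i, l) * P $$ (l, j) * e j)"
    by (subst sum.swap) (simp add: sum_distrib_left mult.assoc)
  also have "\<dots> = (\<Sum>j<n. (M * P) $$ (i, j) * e j)"
    by (simp add: MP sum_distrib_right)
  finally have 1: "x * b i = \<dots>" .
  have "x * b i = (\<Sum>l<n. P $$ (i, l) * (x * e l))"
    using ij by (simp add: bP sum_distrib_left mult_ac)
  also have "\<dots> = (\<Sum>l<n. P $$ (i, l) * (\<Sum>j<n. N $$ (l, j) * e j))"
    by (intro sum.cong) (simp_all add: eN)
  also have "\<dots> = (\<Sum>j<n. \<Sum>l<n. P $$ (i, l) * N $$ (l, j) * e j)"
    by (subst sum.swap) (simp add: sum_distrib_left mult.assoc)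
  also have "\<dots> = (\<Sum>j<n. (P * N) $$ (i, j) * e j)"
    by (simp add: PN sum_distrib_right)
  finally have 2: "x * b i = \<dots>" .
  have 3: "(M * P) $$ (i, j) \<in> K" if "j < n" for j
    unfolding MP[OF that] using ij that
    by (intro is_subfield_sum[OF K] is_subfield_mult[OF K] M P) auto
  have 4: "(P * N) $$ (i, j) \<in> K" if "j < n" for j
    unfolding PN[OF that] using ij that
    by (intro is_subfield_sum[OF K] is_subfield_mult[OF K] N P) auto
  show "(M * P) $$ (i, j) = (P * N) $$ (i, j)"
    by (rule basis_coeffs_unique[OF e xb[OF ij(1)], where c = "\<lambda>j. (M * P) $$ (i, j)"
          and d = "\<lambda>j. (P * N) $$ (i, j)", OF 3 4 1 2 ij(2)])
qed (use M P N in auto)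

lemma is_basis_over_coeff_matrix:
  assumes e: "is_basis_over K L m e" and b: "\<And>i. i < n \<Longrightarrow> b i \<in> L"
  obtains P where "P \<in> carrier_mat n m" "\<And>i l. i < n \<Longrightarrow> l < m \<Longrightarrow> P $$ (i, l) \<in> K"
    "\<And>i. i < n \<Longrightarrow> b i = (\<Sum>l<m. P $$ (i, l) * e l)"
proof -
  have "\<exists>c. c \<in> {..<m} \<rightarrow>\<^sub>E K \<and> b i = (\<Sum>l<m. c l * e l)" if "i < n" for i
    using e b[OF that] unfolding is_basis_over_def by blast
  then obtain c where c: "\<And>i. i < n \<Longrightarrow> c i \<in> {..<m} \<rightarrow>\<^sub>E K"
    "\<And>i. i < n \<Longrightarrow> b i = (\<Sum>l<m. c i l * e l)" by metis
  show ?thesis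
    by (rule that[of "mat n m (\<lambda>(i, l). c i l)"]) (use c in \<open>auto simp: PiE_def Pi_def\<close>)
qed

lemma field_norm_eq_det:
  assumes K: "is_subfield K" and L: "\<And>y. y \<in> L \<Longrightarrow> x * y \<in> L" and e: "is_basis_over K L n e"
    and N: "N \<in> carrier_mat n n" "\<And>i l. i < n \<Longrightarrow> l < n \<Longrightarrow> N $$ (i, l) \<in> K"
    and eN: "\<And>i. i < n \<Longrightarrow> x * e i = (\<Sum>l<n. N $$ (i, l) * e l)"
  shows "field_norm K L x = det N"
  unfolding field_norm_def
proof (rule the_equality)
  show "\<exists>n b M. is_basis_over K L n b \<and> M \<in> carrier_mat n n \<and> (\<forall>i<n. \<forall>l<n. M $$ (i, l) \<in> K) \<and>
     (\<forall>i<n. x * b i = (\<Sum>l<n. M $$ (i, l) * b l)) \<and> det N = det M"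
    using e N eN by blast
next
  fix y assume "\<exists>n b M. is_basis_over K L n b \<and> M \<in> carrier_mat n n \<and>
     (\<forall>i<n. \<forall>l<n. M $$ (i, l) \<in> K) \<and>
     (\<forall>i<n. x * b i = (\<Sum>l<n. M $$ (i, l) * b l)) \<and> y = det M"
  then obtain m b M where b: "is_basis_over K L m b"
    and M: "M \<in> carrier_mat m m" "\<And>i l. i < m \<Longrightarrow> l < m \<Longrightarrow> M $$ (i, l) \<in> K"
    and bM: "\<And>i. i < m \<Longrightarrow> x * b i = (\<Sum>l<m. M $$ (i, l) * b l)" and y: "y = det M"
    by blast
  have bL: "b i \<in> L" if "i < m" for i using b that by (simp add: is_basis_over_def)
  have eL: "e i \<in> L" if "i < n" for i using e that by (simp add: is_basis_over_def)
  obtain P where P: "P \<in> carrier_mat m n" "\<And>i l. i < m \<Longrightarrow> l < n \<Longrightarrow> P $$ (i, l) \<in> K"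
    and bP: "\<And>i. i < m \<Longrightarrow> b i = (\<Sum>l<n. P $$ (i, l) * e l)"
    using is_basis_over_coeff_matrix[where b = b, OF e bL] by blast
  obtain Q where Q: "Q \<in> carrier_mat n m" "\<And>i l. i < n \<Longrightarrow> l < m \<Longrightarrow> Q $$ (i, l) \<in> K"
    and eQ: "\<And>i. i < n \<Longrightarrow> e i = (\<Sum>l<m. Q $$ (i, l) * b l)"
    using is_basis_over_coeff_matrix[where b = e, OF b eL] by blast
  have PQ: "P * Q = 1\<^sub>m m" by (rule basis_change_inverse[OF K b P(1) Q(1) P(2) Q(2) bP eQ])
  have QP: "Q * P = 1\<^sub>m n" by (rule basis_change_inverse[OF K e Q(1) P(1) Q(2) P(2) eQ bP])
  have mn: "m = n"
    using right_inverse_mat_imp_le[OF P(1) Q(1) PQ] right_inverse_mat_imp_le[OF Q(1) P(1) QP] by simp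
  have "M * P = P * N"
    by (rule basis_matrix_intertwine[OF K e M[unfolded mn] bM[unfolded mn] N eN P[unfolded mn]
          bP[unfolded mn] L[OF bL[unfolded mn]]])
  then have "det M * det P = det P * det N"
    using M(1) N(1) P(1) unfolding mn by (metis det_mult)
  moreover have "det P * det Q = 1"
    using det_mult[of P n Q] P Q mn PQ by simp
  then have "det P \<noteq> 0" by auto
  ultimately show "y = det N" using y by simp
qed

text \<open>
  The norm form of a quadratic extension. The matrix of multiplication by \<open>x + y w\<close> in the basis
  \<open>1, w\<close> has rows \<open>(x, y)\<close> and \<open>(w\<^sup>2 y, x)\<close>; since \<open>y \<noteq> 0\<close>, adjoining \<open>x + y w\<close> is the same
  as adjoining \<open>w\<close>.
\<close>

lemma field_norm_quadratic:
  fixes w x y :: "'c::field"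
  assumes K: "is_subfield K" and ww: "w\<^sup>2 \<in> K" and w: "w \<notin> K"
    and xy: "x \<in> K" "y \<in> K" "y \<noteq> 0"
  shows "field_norm K (adjoin K (x + y * w)) (x + y * w) = x\<^sup>2 - w\<^sup>2 * y\<^sup>2"
proof -
  define L where "L = {a + b * w | a b. a \<in> K \<and> b \<in> K}"
  note cl = is_subfield_closed[OF K]
  have LI: "a + b * w \<in> L" if "a \<in> K" "b \<in> K" for a b using that by (auto simp: L_def)
  have zero: "a = 0 \<and> b = 0" if "a \<in> K" "b \<in> K" "a + b * w = 0" for a b
  proof -
    have "b = 0"
    proof (rule ccontr)
      assume "b \<noteq> 0"
      then have "w = - a / b" using that(3) by (simp add: field_simps eq_neg_iff_add_eq_0)
      then show False using w that cl by metis
    qed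
    then show ?thesis using that by simp
  qed
  have mult: "(a + b * w) * (c + d * w) = (a * c + w\<^sup>2 * (b * d)) + (a * d + b * c) * w" for a b c d
    by (simp add: algebra_simps power2_eq_square)
  have L_mult: "u * v \<in> L" if "u \<in> L" "v \<in> L" for u v
  proof -
    from that obtain a b c d where "a \<in> K" "b \<in> K" "c \<in> K" "d \<in> K" "u = a + b * w" "v = c + d * w"
      unfolding L_def by blast
    then show ?thesis using mult[of a b c d] by (auto intro!: LI cl ww)
  qed
  have "is_subfield L"
    unfolding is_subfield_def
  proof (intro conjI ballI)
    show "0 \<in> L" "1 \<in> L" using LI[of 0 0] LI[of 1 0] by (simp_all add: cl)
    fix u v assume "u \<in> L" "v \<in> L"
    then show "u * v \<in> L" by (rule L_mult)
    from \<open>u \<in> L\<close> \<open>v \<in> L\<close> obtain a b c d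
      where *: "a \<in> K" "b \<in> K" "c \<in> K" "d \<in> K" "u = a + b * w" "v = c + d * w"
      unfolding L_def by blast
    then have eq: "u - v = (a - c) + (b - d) * w" by (simp add: algebra_simps)
    show "u - v \<in> L" unfolding eq by (intro LI is_subfield_minus[OF K] *)
  next
    fix u assume "u \<in> L"
    then obtain a b where *: "a \<in> K" "b \<in> K" "u = a + b * w" unfolding L_def by blast
    show "inverse u \<in> L"
    proof (cases "u = 0")
      case True
      then show ?thesis using LI[of 0 0] by (simp add: cl)
    next
      case False
      then have nz: "a - b * w \<noteq> 0"
        using zero[of a "- b"] * by (auto simp: cl)
      define m where "m = a\<^sup>2 - w\<^sup>2 * b\<^sup>2"
      have m: "m = u * (a - b * w)" unfolding m_def * by (simp add: algebra_simps power2_eq_square)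
      have "inverse u = (a - b * w) / m"
        unfolding m using False nz by (simp add: divide_inverse)
      then have eq: "inverse u = a / m + (- (b / m)) * w"
        by (simp add: diff_divide_distrib)
      have "m \<in> K" unfolding m_def power2_eq_square[of a] power2_eq_square[of b]
        using * by (auto intro!: cl ww)
      then show ?thesis unfolding eq
        by (intro LI is_subfield_divide[OF K] is_subfield_uminus[OF K] *)
    qed
  qed
  have KL: "K \<subseteq> L" using LI[where b = 0] by (auto simp: cl)
  have adj: "adjoin K (x + y * w) = L"
    unfolding adjoin_def
  proof (rule hull_unique)
    show "insert (x + y * w) K \<subseteq> L" using KL LI xy by auto
    show "is_subfield L" by fact
    fix F assume F: "insert (x + y * w) K \<subseteq> F" "is_subfield F"
    note clF = is_subfield_closed[OF F(2)]
    have "w = ((x + y * w) - x) / y" using xy by simp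
    then have "w \<in> F" using F xy clF by (metis insert_subset subsetD)
    then show "L \<subseteq> F" using F by (auto simp: L_def intro!: clF)
  qed
  define e where "e i = (if i = 0 then 1 else w)" for i :: nat
  have basis: "is_basis_over K L 2 e"
    unfolding is_basis_over_def
  proof (intro conjI ballI allI impI)
    fix i :: nat show "e i \<in> L"
      using LI[of 1 0] LI[of 0 1] by (simp add: e_def cl)
  next
    fix z assume "z \<in> L"
    then obtain a b where *: "a \<in> K" "b \<in> K" "z = a + b * w" unfolding L_def by blast
    show "\<exists>!c. c \<in> {..<2} \<rightarrow>\<^sub>E K \<and> z = (\<Sum>i<2. c i * e i)"
    proof (rule ex1I[of _ "\<lambda>i\<in>{..<2::nat}. if i = 0 then a else b"])
      show "(\<lambda>i\<in>{..<2}. if i = 0 then a else b) \<in> {..<2::nat} \<rightarrow>\<^sub>E K \<and>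
        z = (\<Sum>i<2. (\<lambda>i\<in>{..<2}. if i = 0 then a else b) i * e i)"
        using * by (auto simp: e_def numeral_2_eq_2)
    next
      fix c assume "c \<in> {..<2::nat} \<rightarrow>\<^sub>E K \<and> z = (\<Sum>i<2. c i * e i)"
      then have c: "c \<in> {..<2} \<rightarrow>\<^sub>E K" and "z = (\<Sum>i<2. c i * e i)" by blast+
      then have "(c 0 - a) + (c 1 - b) * w = 0" using * by (simp add: e_def numeral_2_eq_2 algebra_simps)
      moreover have "c 0 \<in> K" "c 1 \<in> K" using PiE_mem[OF c] by simp_all
      ultimately have "c 0 = a" "c 1 = b" using zero[of "c 0 - a" "c 1 - b"] * by (auto simp: cl)
      then show "c = (\<lambda>i\<in>{..<2}. if i = 0 then a else b)"
      proof (intro PiE_ext[OF c])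
        show "(\<lambda>i\<in>{..<2}. if i = 0 then a else b) \<in> {..<2::nat} \<rightarrow>\<^sub>E K" using * by auto
      qed (use \<open>c 0 = a\<close> \<open>c 1 = b\<close> in \<open>auto simp: less_2_cases_iff\<close>)
    qed
  qed
  define M where "M = mat 2 2 (\<lambda>(i, l). [[x, y], [w\<^sup>2 * y, x]] ! i ! l)"
  have "field_norm K L (x + y * w) = det M"
  proof (rule field_norm_eq_det[OF K _ basis])
    show "(x + y * w) * u \<in> L" if "u \<in> L" for u using that L_mult LI xy by blast
    show "M \<in> carrier_mat 2 2" by (simp add: M_def)
    show "M $$ (i, l) \<in> K" if "i < 2" "l < 2" for i l
      using that xy ww by (auto simp: M_def less_2_cases_iff cl)
    show "(x + y * w) * e i = (\<Sum>l<2. M $$ (i, l) * e l)" if "i < 2" for i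
      using that by (auto simp: M_def less_2_cases_iff e_def numeral_2_eq_2
          algebra_simps power2_eq_square)
  qed
  also have "det M = x\<^sup>2 - w\<^sup>2 * y\<^sup>2"
    by (subst det_carrier_mat_2) (simp_all add: M_def power2_eq_square algebra_simps)
  finally show ?thesis by (simp add: adj)
qed

section \<open>The rational function field inside its completion\<close>

lemma fls_of_poly_pCons: "fls_of_poly (pCons a p) = fls_const a + fls_X_inv * fls_of_poly p"
  by (simp add: fls_of_poly_def map_poly_pCons)

lemma fls_of_poly_nth: "fls_nth (fls_of_poly p) m = (if m \<le> 0 then coeff p (nat (- m)) else 0)"
proof (induction p arbitrary: m)
  case 0
  then show ?case by (simp add: fls_of_poly_def)
next
  case (pCons a p)
  have "fls_nth (fls_of_poly (pCons a p)) m = fls_nth (fls_const a) m + fls_nth (fls_of_poly p) (m + 1)"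
    by (simp add: fls_of_poly_pCons fls_X_inv_times_conv_shift)
  then show ?case
    unfolding pCons.IH by (auto simp: coeff_pCons nat_eq_iff Suc_nat_eq_nat_zadd1 split: nat.splits)
qed

lemma inj_comm_ring_hom_fls_of_poly: "inj_comm_ring_hom (fls_of_poly :: 'a::field poly \<Rightarrow> _)"
proof -
  have add: "fls_of_poly (p + q) = fls_of_poly p + fls_of_poly q" for p q :: "'a poly"
    by (rule fls_eqI) (simp add: fls_of_poly_nth)
  have smult: "fls_of_poly (Polynomial.smult c p) = fls_const c * fls_of_poly p" for c and p :: "'a poly"
    by (rule fls_eqI) (simp add: fls_of_poly_nth)
  have mult: "fls_of_poly (p * q) = fls_of_poly p * fls_of_poly q" for p q :: "'a poly"
  proof (induction p)
    case 0
    then show ?case by (simp add: fls_of_poly_def)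
  next
    case (pCons a p)
    then show ?case by (simp add: add smult fls_of_poly_pCons algebra_simps)
  qed
  have "p = 0" if "fls_of_poly p = 0" for p :: "'a poly"
  proof (rule poly_eqI)
    fix n
    show "coeff p n = coeff 0 n"
      using fls_of_poly_nth[of p "- int n"] that by simp
  qed
  then show ?thesis
    by unfold_locales (auto simp: add mult, simp_all add: fls_of_poly_def map_poly_1)
qed

lemma inj_comm_ring_hom_emb_A:
  assumes "field_hom \<iota>"
  shows "inj_comm_ring_hom (emb_A \<iota>)"
proof -
  interpret i: field_hom \<iota> by fact
  interpret f: inj_comm_ring_hom fls_of_poly by (rule inj_comm_ring_hom_fls_of_poly)
  show ?thesis
    by unfold_locales (simp_all add: emb_A_def hom_distribs)
qed

lemma is_subfield_field_k:
  assumes "field_hom \<iota>"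
  shows "is_subfield (field_k \<iota>)"
proof -
  interpret e: inj_comm_ring_hom "emb_A \<iota>" by (rule inj_comm_ring_hom_emb_A) fact
  have I: "emb_A \<iota> a / emb_A \<iota> b \<in> field_k \<iota>" if "b \<noteq> 0" for a b
    using that by (auto simp: field_k_def)
  show ?thesis
    unfolding is_subfield_def
  proof (intro conjI ballI)
    show "0 \<in> field_k \<iota>" "1 \<in> field_k \<iota>" using I[of 1 0] I[of 1 1] by simp_all
  next
    fix x y assume "x \<in> field_k \<iota>" "y \<in> field_k \<iota>"
    then obtain a b c d where *: "b \<noteq> 0" "d \<noteq> 0"
      "x = emb_A \<iota> a / emb_A \<iota> b" "y = emb_A \<iota> c / emb_A \<iota> d"
      unfolding field_k_def by blast
    have "x - y = emb_A \<iota> (a * d - c * b) / emb_A \<iota> (b * d)"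
      using * by (simp add: hom_distribs diff_frac_eq)
    moreover have "x * y = emb_A \<iota> (a * c) / emb_A \<iota> (b * d)"
      using * by (simp add: hom_distribs)
    ultimately show "x - y \<in> field_k \<iota>" "x * y \<in> field_k \<iota>"
      using I[of "b * d"] * by simp_all
  next
    fix x assume "x \<in> field_k \<iota>"
    then obtain a b where *: "b \<noteq> 0" "x = emb_A \<iota> a / emb_A \<iota> b"
      unfolding field_k_def by blast
    show "inverse x \<in> field_k \<iota>"
      using I[of a b] I[of 1 0] * by (cases "a = 0") simp_all
  qed
qed

lemma emb_A_in_field_k:
  assumes "field_hom \<iota>"
  shows "emb_A \<iota> a \<in> field_k \<iota>"
proof -
  interpret e: inj_comm_ring_hom "emb_A \<iota>" by (rule inj_comm_ring_hom_emb_A) fact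
  show ?thesis unfolding field_k_def by (rule CollectI, rule exI[of _ a], rule exI[of _ 1]) simp
qed

text \<open>
  The square root \<open>w\<close> of \<open>d = (2 T)\<^sup>2 + e\<close> is irrational, by descent on the denominator. If
  \<open>q w = p\<close> is a polynomial, then so are \<open>q' = p - 2 T q\<close> and \<open>q' w = q d - 2 T p\<close>. As
  \<open>(p - 2 T q) (p + 2 T q) = e q\<^sup>2\<close> while the two factors differ by \<open>4 T q\<close>, one of them has smaller
  degree than \<open>q\<close>; changing the sign of \<open>p\<close> if necessary, it is the first.
\<close>

lemma no_rational_sqrt_square_plus_const:
  fixes p q :: "'a::field poly"
  assumes two: "(2::'a) \<noteq> 0" and e: "e \<noteq> 0"
    and "p\<^sup>2 = q\<^sup>2 * ((2 * poly_T)\<^sup>2 + [:e:])"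
  shows "q = 0"
  using assms(3)
proof (induction "degree q" arbitrary: p q rule: less_induct)
  case less
  define r :: "'a poly" where "r = 2 * poly_T"
  define d where "d = r\<^sup>2 + [:e:]"
  have eq: "p\<^sup>2 = q\<^sup>2 * d" using less.prems by (simp add: d_def r_def)
  show ?case
  proof (rule ccontr)
    assume q: "q \<noteq> 0"
    have descent: False if s: "s\<^sup>2 = q\<^sup>2 * d" and lt: "degree (s - r * q) < degree q" for s
    proof -
      have "(s - r * q)\<^sup>2 * d = (q * d - r * s)\<^sup>2 + (s\<^sup>2 - q\<^sup>2 * d) * (d - r\<^sup>2)"
        by Groebner_Basis.algebra
      then have "(s - r * q)\<^sup>2 * d = (q * d - r * s)\<^sup>2"
        using s by simp
      then have "s - r * q = 0"
        using less.hyps[OF lt, of "q * d - r * s"] by (simp add: d_def r_def)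
      then have "s\<^sup>2 = r\<^sup>2 * q\<^sup>2" by (simp add: power_mult_distrib)
      then have "[:e:] * q\<^sup>2 = 0" using s by (simp add: d_def algebra_simps)
      then show False using q e by simp
    qed
    have "(p - r * q) * (p + r * q) = p\<^sup>2 - r\<^sup>2 * q\<^sup>2" by Groebner_Basis.algebra
    also have "\<dots> = [:e:] * q\<^sup>2"
      using eq by (simp add: d_def algebra_simps)
    finally have prod: "(p - r * q) * (p + r * q) = [:e:] * q\<^sup>2" .
    moreover have "[:e:] * q\<^sup>2 \<noteq> 0" using q e by simp
    ultimately have "p - r * q \<noteq> 0" "p + r * q \<noteq> 0" by auto
    then have "degree (p - r * q) + degree (p + r * q) = degree ([:e:] * q\<^sup>2)"
      by (metis prod degree_mult_eq)
    also have "\<dots> = 2 * degree q" using q e by (simp add: degree_mult_eq degree_power_eq)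
    finally have sum: "degree (p - r * q) + degree (p + r * q) = 2 * degree q" .
    have r: "2 * r = [:0, 2 * 2:]" by (simp add: r_def numeral_poly)
    have four: "2 * 2 \<noteq> (0::'a)" using two by (simp only: mult_eq_0_iff) simp
    have "degree (2 * r * q) = Suc (degree q)"
      using q four unfolding r by (subst degree_mult_eq) auto
    moreover have "2 * r * q = (p + r * q) - (p - r * q)" by (simp add: algebra_simps)
    ultimately have "degree q < max (degree (p + r * q)) (degree (p - r * q))"
      using degree_diff_le_max[of "p + r * q" "p - r * q"] by simp
    then consider "degree (p - r * q) < degree q" | "degree (p + r * q) < degree q"
      using sum by linarith
    then show False
    proof cases
      case 1
      then show False using descent eq by blast
    next
      case 2
      have "- p - r * q = - (p + r * q)" by simp
      then have "degree (- p - r * q) < degree q" using 2 by (metis degree_minus)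
      then show False using descent[of "- p"] eq by simp
    qed
  qed
qed

section \<open>Arithmetic in characteristic five\<close>

text \<open>
  Translation by \<open>1\<close> permutes the ring, so the sum of all elements equals itself plus the
  number of elements.
\<close>

lemma of_nat_CARD_eq_0: "of_nat CARD('a) = (0 :: 'a::{finite,ring_1})"
proof -
  have "(\<Sum>x\<in>UNIV. x) = (\<Sum>x\<in>UNIV. x + 1 :: 'a)"
    by (rule sum.reindex_bij_witness[of _ "\<lambda>x. x + 1" "\<lambda>x. x - 1"]) auto
  then show ?thesis by (simp add: sum.distrib)
qed

lemma fifth_power_add_char_5:
  fixes x y :: "'r::idom"
  assumes "(5::'r) = 0"
  shows "(x + y) ^ 5 = x ^ 5 + y ^ 5"
proof -
  have "(x + y) ^ 5 = x ^ 5 + y ^ 5 + 5 * (x ^ 4 * y + 2 * x ^ 3 * y ^ 2 + 2 * x ^ 2 * y ^ 3 + x * y ^ 4)"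
    by Groebner_Basis.algebra
  then show ?thesis using assms by simp
qed

text \<open>
  Explicit multiples of \<open>5\<close> make congruences modulo \<open>5\<close> into polynomial identities with integer
  coefficients, which hold in every commutative ring.
\<close>

lemma eq_mod_5: "(5::'r::comm_ring_1) = 0 \<Longrightarrow> a = b + 5 * k \<Longrightarrow> a = (b::'r)"
  by simp

section \<open>The endomorphism that squares to the discriminant\<close>

text \<open>
  Let \<open>u\<close> be the endomorphism with constant coefficient \<open>s\<close>. Both \<open>u\<^sup>2\<close> and
  \<open>\<Phi>\<^sub>D = 2 \<Phi>\<^sub>T\<^sup>2 + c\<close> are endomorphisms with constant coefficient \<open>D\<close>, hence equal. As
  \<open>\<Phi>\<^sub>D\<close> has degree \<open>4\<close> in \<open>\<tau>\<close>, this leaves \<open>u = s + a \<tau> + b \<tau>\<^sup>2\<close>. The equations for \<open>a\<close> and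
  \<open>b\<close> are the coefficients of \<open>\<tau>\<close> and \<open>\<tau>\<^sup>2\<close> in \<open>u \<Phi>\<^sub>T = \<Phi>\<^sub>T u\<close>. The coefficient of \<open>\<tau>\<^sup>4\<close> there says
  that \<open>b / \<Delta>\<close> is fixed by the \<open>25\<close>-th power map, and the one in \<open>u\<^sup>2 = \<Phi>\<^sub>D\<close> that its \<open>26\<close>-th power is
  \<open>2\<close>; together they show that \<open>b / \<Delta>\<close> is a square root of \<open>2\<close>.
\<close>

lemma endomorphism_sqrt_discriminant:
  fixes \<iota> :: "'a::{finite,field} fls \<Rightarrow> 'c::{field,complete_space}"
  assumes hom: "field_hom \<iota>" and q: "CARD('a) = 5"
    and c: "c ^ 5 = (c :: 'a)" and D: "D = 2 * poly_T\<^sup>2 + [:c:]"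
    and \<Delta>: "\<Delta> \<noteq> 0" and s: "s\<^sup>2 = emb_A \<iota> D" and s_End: "s \<in> drinfeld_End_const \<iota> g \<Delta>"
  obtains a b where "a * (emb_A \<iota> poly_T ^ 5 - emb_A \<iota> poly_T) = g * (s ^ 5 - s)"
    "b * (emb_A \<iota> poly_T ^ 25 - emb_A \<iota> poly_T) = \<Delta> * (s ^ 25 - s) + g * a ^ 5 - a * g ^ 5"
    "b\<^sup>2 = 2 * \<Delta>\<^sup>2"
proof -
  interpret e: inj_comm_ring_hom "emb_A \<iota>" by (rule inj_comm_ring_hom_emb_A) fact
  define t where "t = emb_A \<iota> poly_T"
  define cc where "cc = emb_A \<iota> [:c:]"
  define \<Phi> where "\<Phi> = drinfeld_T \<iota> g \<Delta>"
  have \<Phi>: "\<Phi> = [:t, g, \<Delta>:]" by (simp add: \<Phi>_def drinfeld_T_def t_def)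
  have five_a: "(5::'a) = 0" using of_nat_CARD_eq_0[where 'a = 'a] q by simp
  then have "(5::'a poly) = 0" by (simp add: numeral_poly)
  then have "emb_A \<iota> 5 = 0" by simp
  then have five: "(5::'c) = 0" by (simp only: e.hom_numeral)
  note frob = fifth_power_add_char_5[OF five]
  have q5: "(0::nat) < 5" by simp
  have "(2::'c) ^ 5 = 2 + 5 * 6" by simp
  then have two5: "(2::'c) ^ 5 = 2" by (rule eq_mod_5[OF five])
  have two: "(2::'c) \<noteq> 0"
  proof
    assume "(2::'c) = 0"
    moreover have "(1::'c) = 5 - 2 * 2" by simp
    ultimately show False using five by simp
  qed
  have "cc ^ 5 = emb_A \<iota> ([:c:] ^ 5)" by (simp add: cc_def e.hom_power)
  also have "[:c:] ^ 5 = [:c:]" using c by (simp add: poly_const_pow)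
  finally have cc5: "cc ^ 5 = cc" by (simp add: cc_def)
  have d: "emb_A \<iota> D = 2 * t\<^sup>2 + cc"
    by (simp add: D t_def cc_def e.hom_add e.hom_mult e.hom_power e.hom_numeral)
  have generic: "t ^ (5 ^ n) \<noteq> t" if "n > 0" for n
  proof
    assume "t ^ (5 ^ n) = t"
    then have "emb_A \<iota> (poly_T ^ (5 ^ n)) = emb_A \<iota> poly_T" by (simp add: t_def e.hom_power)
    then have "poly_T ^ (5 ^ n) = (poly_T :: 'a poly)" by simp
    then have "degree ((poly_T :: 'a poly) ^ (5 ^ n)) = degree (poly_T :: 'a poly)" by simp
    then show False using that by (simp add: degree_power_eq)
  qed
  obtain u where "u \<in> drinfeld_End \<iota> g \<Delta>" and u0: "coeff u 0 = s"
    using s_End by (auto simp: drinfeld_End_const_def)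
  then have comm: "twisted_mult 5 u \<Phi> = twisted_mult 5 \<Phi> u"
    by (simp add: drinfeld_End_def \<Phi>_def q)
  \<comment> \<open>the endomorphism \<open>\<Phi>\<^sub>D\<close>\<close>
  define W where "W = Polynomial.smult 2 (twisted_mult 5 \<Phi> \<Phi>) + [:cc:]"
  define U where "U = twisted_mult 5 u u - W"
  note assoc = twisted_mult_assoc[OF q5 frob]
  have "twisted_mult 5 W \<Phi> = twisted_mult 5 \<Phi> W"
    by (simp add: W_def twisted_mult_add_left[OF q5 frob] twisted_mult_add_right[OF q5 frob]
        twisted_mult_smult_left[OF q5 frob] twisted_mult_smult_right[OF q5 frob two5]
        twisted_mult_const_left[OF q5 frob] twisted_mult_const_right[OF q5 frob cc5] assoc)
  moreover have "twisted_mult 5 (twisted_mult 5 u u) \<Phi> = twisted_mult 5 \<Phi> (twisted_mult 5 u u)"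
    by (metis assoc comm)
  ultimately have "twisted_mult 5 U \<Phi> = twisted_mult 5 \<Phi> U"
    by (simp add: U_def twisted_mult_diff_left[OF q5 frob] twisted_mult_diff_right[OF q5 frob])
  moreover have "coeff U 0 = 0"
    using s d by (simp add: U_def W_def coeff_twisted_mult u0 \<Phi> power2_eq_square)
  ultimately have "U = 0"
    using generic by (intro twisted_commutant_eq_0[OF q5 frob, where \<Phi> = \<Phi>]) (simp_all add: \<Phi>)
  then have uu: "twisted_mult 5 u u = W" by (simp add: U_def)
  have deg_\<Phi>: "degree \<Phi> = 2" using \<Delta> by (simp add: \<Phi>)
  have "coeff \<Phi> 2 = \<Delta>" by (simp add: \<Phi> numeral_2_eq_2)
  then have "coeff (twisted_mult 5 \<Phi> \<Phi>) 4 = \<Delta> * \<Delta> ^ 25"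
    using coeff_twisted_mult_top[OF q5, of \<Phi> \<Phi>] by (simp add: deg_\<Phi>)
  then have W4: "coeff W 4 = 2 * \<Delta> * \<Delta> ^ 25"
    by (simp add: W_def deg_\<Phi> coeff_pCons split: nat.split)
  have "degree W = 4"
  proof -
    have "degree (twisted_mult 5 \<Phi> \<Phi>) = 4"
      using \<Delta> deg_\<Phi> by (subst degree_twisted_mult[OF q5]) (auto simp: \<Phi>)
    then show ?thesis unfolding W_def using two by (subst degree_add_eq_left) simp_all
  qed
  moreover have "u \<noteq> 0"
    using uu \<open>degree W = 4\<close> by (auto simp: twisted_mult_def)
  ultimately have deg_u: "degree u = 2"
    using degree_twisted_mult[OF q5, of u u] uu by simp
  define a b where "a = coeff u 1" and "b = coeff u 2"
  have u_high: "coeff u 3 = 0" "coeff u 4 = 0" using deg_u by (simp_all add: coeff_eq_0)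
  have \<Phi>_coeff: "coeff \<Phi> 0 = t" "coeff \<Phi> (Suc 0) = g" "coeff \<Phi> 2 = \<Delta>" "coeff \<Phi> 3 = 0" "coeff \<Phi> 4 = 0"
    by (simp_all add: \<Phi> numeral_eq_Suc)
  have u_coeff: "coeff u (Suc 0) = a" "coeff u 2 = b" by (simp_all add: a_def b_def)
  have sets: "{0..Suc 0} = {0, Suc 0}" "{0..2::nat} = {0, 1, 2}" "{0..4::nat} = {0, 1, 2, 3, 4}" by auto
  note cf = coeff_twisted_mult[OF q5] sets u0 u_coeff u_high \<Phi>_coeff
  have "b * b ^ 25 = 2 * \<Delta> * \<Delta> ^ 25"
    using coeff_twisted_mult_top[OF q5, of u u] uu W4 by (simp add: deg_u b_def)
  moreover have "coeff (twisted_mult 5 u \<Phi>) 4 = coeff (twisted_mult 5 \<Phi> u) 4" using comm by simp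
  then have "b * \<Delta> ^ 25 = \<Delta> * b ^ 25"
    by (simp add: cf)
  ultimately have "b\<^sup>2 * \<Delta> ^ 25 = 2 * \<Delta>\<^sup>2 * \<Delta> ^ 25"
    by Groebner_Basis.algebra
  then have b: "b\<^sup>2 = 2 * \<Delta>\<^sup>2" using \<Delta> by simp
  have "coeff (twisted_mult 5 u \<Phi>) 1 = coeff (twisted_mult 5 \<Phi> u) 1" using comm by simp
  then have a1: "a * (t ^ 5 - t) = g * (s ^ 5 - s)"
    by (simp add: cf algebra_simps)
  have "coeff (twisted_mult 5 u \<Phi>) 2 = coeff (twisted_mult 5 \<Phi> u) 2" using comm by simp
  then have b1: "b * (t ^ 25 - t) = \<Delta> * (s ^ 25 - s) + g * a ^ 5 - a * g ^ 5"
    by (simp add: cf algebra_simps)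
  show ?thesis using that[of a b] a1 b1 b by (simp add: t_def)
qed

section \<open>The norm of a singular modulus as a rational function\<close>

text \<open>
  With \<open>a\<close> and \<open>b\<close> as above, \<open>s\<^sup>5 = s D\<^sup>2\<close> and \<open>s ^ 25 = s D ^ 12\<close> turn the equation for \<open>a\<close> into
  \<open>a E = g s (D\<^sup>2 - 1)\<close>. Eliminating \<open>a\<close> from the equation for \<open>b\<close> gives
  \<open>E\<^sup>5 F b = E\<^sup>5 \<Delta> s (D ^ 12 - 1) + g\<^sup>6 s P\<close>. Multiplied by \<open>s / \<Delta>\<close> it becomes, with \<open>w = b s / \<Delta>\<close>,
  \<open>E\<^sup>5 F w = E\<^sup>5 D (D ^ 12 - 1) + j D P\<close>.
  This is linear in \<open>j\<close>, and \<open>w\<^sup>2 = 2 D\<close> is a polynomial without a rational square root. So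
  \<open>k(j) = k(w)\<close>, and the norm is read off from the norm form of this quadratic extension.
\<close>

lemma norm_of_singular_modulus:
  fixes \<iota> :: "'a::{finite,field} fls \<Rightarrow> 'c::{field,complete_space}"
  assumes hom: "field_hom \<iota>" and q: "CARD('a) = 5"
    and c: "c ^ 5 = (c :: 'a)" "c \<noteq> 0" and D: "D = 2 * poly_T\<^sup>2 + [:c:]"
    and E: "E = poly_T ^ 5 - poly_T" and F: "F = poly_T ^ 25 - poly_T"
    and P: "P = D\<^sup>2 * (D\<^sup>2 - 1) ^ 5 - (D\<^sup>2 - 1) * E ^ 4" "P \<noteq> 0"
    and N: "N * D * P\<^sup>2 = E ^ 10 * (D * (D ^ 12 - 1)\<^sup>2 - 2 * F\<^sup>2)"
    and j: "singular_modulus_with_discriminant \<iota> D j"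
  shows "norm_over_k \<iota> j = emb_A \<iota> N"
proof -
  interpret e: inj_comm_ring_hom "emb_A \<iota>" by (rule inj_comm_ring_hom_emb_A) fact
  define t where "t = emb_A \<iota> poly_T"
  define d where "d = emb_A \<iota> D"
  define p where "p = emb_A \<iota> P"
  define n where "n = emb_A \<iota> N"
  define ee where "ee = emb_A \<iota> E"
  define f where "f = emb_A \<iota> F"
  note hd = e.hom_add e.hom_mult e.hom_power e.hom_minus e.hom_numeral
  have five_a: "(5::'a) = 0" using of_nat_CARD_eq_0[where 'a = 'a] q by simp
  have two_a: "(2::'a) \<noteq> 0"
  proof
    assume "(2::'a) = 0"
    moreover have "(1::'a) = 5 - 2 * 2" by simp
    ultimately show False using five_a by simp
  qed
  have ee: "ee = t ^ 5 - t" and f: "f = t ^ 25 - t"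
    by (simp_all add: ee_def f_def E F t_def hd)
  have p: "p = d\<^sup>2 * (d\<^sup>2 - 1) ^ 5 - (d\<^sup>2 - 1) * ee ^ 4"
    unfolding p_def P by (simp add: d_def ee_def hd)
  have "emb_A \<iota> (N * D * P\<^sup>2) = emb_A \<iota> (E ^ 10 * (D * (D ^ 12 - 1)\<^sup>2 - 2 * F\<^sup>2))"
    unfolding N ..
  then have n: "n * d * p\<^sup>2 = ee ^ 10 * (d * (d ^ 12 - 1)\<^sup>2 - 2 * f\<^sup>2)"
    by (simp add: n_def d_def p_def ee_def f_def hd)
  \<comment> \<open>the nonvanishing of all denominators\<close>
  have "coeff D 2 = 2"
    unfolding D by (simp add: numeral_poly numeral_2_eq_2)
  then have "D \<noteq> 0" using two_a by auto
  then have d0: "d \<noteq> 0" by (simp add: d_def)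
  have p0: "p \<noteq> 0" using P by (simp add: p_def)
  have "poly_T ^ k - poly_T \<noteq> (0 :: 'a poly)" if "k > 1" for k
  proof
    assume "poly_T ^ k - poly_T = (0 :: 'a poly)"
    then have "degree ((poly_T :: 'a poly) ^ k) = degree (poly_T :: 'a poly)" by simp
    then show False using that by (simp add: degree_power_eq)
  qed
  then have ee0: "ee \<noteq> 0" and f0: "f \<noteq> 0" by (simp_all add: ee_def f_def E F)
  from j obtain g \<Delta> s where \<Delta>: "\<Delta> \<noteq> 0" and jg: "j = g ^ 6 / \<Delta>" and s: "s\<^sup>2 = d"
    and "drinfeld_End_const \<iota> g \<Delta> = {emb_A \<iota> a + emb_A \<iota> b * s | a b. True}"
    unfolding singular_modulus_with_discriminant_def drinfeld_j_def q d_def by auto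
  moreover have "s = emb_A \<iota> 0 + emb_A \<iota> 1 * s" by simp
  ultimately have "s \<in> drinfeld_End_const \<iota> g \<Delta>" by blast
  then obtain a b where a: "a * ee = g * (s ^ 5 - s)"
    and b: "b * f = \<Delta> * (s ^ 25 - s) + g * a ^ 5 - a * g ^ 5" and bb: "b\<^sup>2 = 2 * \<Delta>\<^sup>2"
    using endomorphism_sqrt_discriminant[OF hom q c(1) D \<Delta>] s unfolding d_def ee f t_def by blast
  define w where "w = b * s / \<Delta>"
  have w: "w\<^sup>2 = 2 * d"
    using \<Delta> by (simp add: w_def power_mult_distrib power_divide bb s)
  have s5: "s ^ 5 = s * d\<^sup>2" and s25: "s ^ 25 = s * d ^ 12"
    unfolding s[symmetric] by (simp_all flip: power_mult power_Suc)
  have a': "a * ee = g * s * (d\<^sup>2 - 1)" using a by (simp add: s5 algebra_simps)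
  have "ee ^ 5 * (g * a ^ 5 - a * g ^ 5) = g * (a * ee) ^ 5 - (a * ee) * ee ^ 4 * g ^ 5"
    by Groebner_Basis.algebra
  also have "\<dots> = g ^ 6 * (s ^ 5 * (d\<^sup>2 - 1) ^ 5 - s * (d\<^sup>2 - 1) * ee ^ 4)"
    unfolding a' by Groebner_Basis.algebra
  also have "\<dots> = g ^ 6 * s * p" unfolding s5 p by Groebner_Basis.algebra
  finally have "ee ^ 5 * (b * f) = ee ^ 5 * (\<Delta> * s * (d ^ 12 - 1)) + g ^ 6 * s * p"
    unfolding b s25 by (simp add: algebra_simps)
  then have "ee ^ 5 * (b * f) * s = ee ^ 5 * \<Delta> * d * (d ^ 12 - 1) + g ^ 6 * d * p"
    using s by Groebner_Basis.algebra
  then have "ee ^ 5 * w * f = ee ^ 5 * d * (d ^ 12 - 1) + j * d * p"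
    using \<Delta> by (simp add: w_def jg field_simps)
  then have j_eq: "j = - (ee ^ 5 * (d ^ 12 - 1)) / p + ee ^ 5 * f / (d * p) * w"
    using d0 p0 by (simp add: field_simps)
  have K: "is_subfield (field_k \<iota>)" by (rule is_subfield_field_k) fact
  have in_K: "emb_A \<iota> x / emb_A \<iota> y \<in> field_k \<iota>" for x y
    by (intro is_subfield_divide K emb_A_in_field_k hom)
  have w_notin: "w \<notin> field_k \<iota>"
  proof
    assume "w \<in> field_k \<iota>"
    then obtain x y where y: "y \<noteq> 0" and "w = emb_A \<iota> x / emb_A \<iota> y"
      unfolding field_k_def by blast
    then have "(emb_A \<iota> x)\<^sup>2 = (emb_A \<iota> y)\<^sup>2 * (2 * d)"
      unfolding w[symmetric] by (simp add: power_divide)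
    then have "emb_A \<iota> (x\<^sup>2) = emb_A \<iota> (y\<^sup>2 * (2 * D))" by (simp add: hd d_def)
    then have "x\<^sup>2 = y\<^sup>2 * (2 * D)" by (simp only: e.eq_iff)
    also have "2 * D = (2 * poly_T)\<^sup>2 + [:2 * c:]"
      unfolding D by (simp add: power2_eq_square numeral_poly algebra_simps)
    finally have "y = 0"
      using two_a c by (intro no_rational_sqrt_square_plus_const[of "2 * c" x y]) auto
    with y show False by simp
  qed
  have "norm_over_k \<iota> j =
      (- (ee ^ 5 * (d ^ 12 - 1)) / p)\<^sup>2 - w\<^sup>2 * (ee ^ 5 * f / (d * p))\<^sup>2"
    unfolding norm_over_k_def j_eq
  proof (rule field_norm_quadratic[OF K _ w_notin])
    show "w\<^sup>2 \<in> field_k \<iota>"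
      using emb_A_in_field_k[OF hom, of "2 * D"] by (simp add: w d_def hd)
    show "- (ee ^ 5 * (d ^ 12 - 1)) / p \<in> field_k \<iota>"
      using in_K[of "- (E ^ 5 * (D ^ 12 - 1))" P] by (simp add: ee_def d_def p_def hd e.hom_uminus)
    show "ee ^ 5 * f / (d * p) \<in> field_k \<iota>"
      using in_K[of "E ^ 5 * F" "D * P"] by (simp add: ee_def f_def d_def p_def hd)
    show "ee ^ 5 * f / (d * p) \<noteq> 0" using ee0 f0 d0 p0 by simp
  qed
  also have "\<dots> = ee ^ 10 * (d * (d ^ 12 - 1)\<^sup>2 - 2 * f\<^sup>2) / (d * p\<^sup>2)"
    unfolding w using d0 p0 by (simp add: divide_simps) Groebner_Basis.algebra
  also have "\<dots> = n"
    unfolding n[symmetric] using d0 p0 by simp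
  finally show ?thesis by (simp add: n_def)
qed

section \<open>Polynomial identities modulo five\<close>

text \<open>
  The remaining identities take place in the variable \<open>y = T\<^sup>2\<close>, in which the discriminant is
  \<open>D = 2 y + c\<close>. The left hand side has degree \<open>25\<close>, but additivity of the fifth power gives
  \<open>D ^ 25 = 2 y ^ 25 + c\<close> and \<open>D ^ 13 = (2 y\<^sup>5 + c)\<^sup>2 D\<^sup>3\<close>, so that the leading terms cancel and only
  degree \<open>12\<close> remains: this is why the norm of \<open>j\<close> has degree \<open>24\<close> in \<open>T\<close>.
\<close>

lemma discriminant_difference_char_5:
  fixes y c :: "'r::idom"
  assumes five: "(5::'r) = 0" and c: "c ^ 5 = c" and D: "D = 2 * y + c"
  shows "D * (D ^ 12 - 1)\<^sup>2 - 2 * (y * (y ^ 12 - 1)\<^sup>2) =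
    2 * (c + 2 * y ^ 13 - (2 * y ^ 5 + c)\<^sup>2 * D ^ 3)"
proof -
  have lin: "(2 * z + c) ^ 5 = 2 * z ^ 5 + c" for z
  proof -
    have "(2 * z) ^ 5 = 2 * z ^ 5 + 5 * (6 * z ^ 5)" by Groebner_Basis.algebra
    then have "(2 * z) ^ 5 = 2 * z ^ 5" by (rule eq_mod_5[OF five])
    then show ?thesis by (simp add: fifth_power_add_char_5[OF five] c)
  qed
  have D5: "D ^ 5 = 2 * y ^ 5 + c" unfolding D by (rule lin)
  have "(D ^ 5) ^ 5 = 2 * (y ^ 5) ^ 5 + c" unfolding D5 by (rule lin)
  then have D25: "D ^ 25 = 2 * y ^ 25 + c" by (simp flip: power_mult)
  have D13: "D ^ 13 = (2 * y ^ 5 + c)\<^sup>2 * D ^ 3"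
    unfolding D5[symmetric] by (simp flip: power_mult power_add)
  have "D * (D ^ 12 - 1)\<^sup>2 - 2 * (y * (y ^ 12 - 1)\<^sup>2) =
      D ^ 25 - 2 * D ^ 13 + D - 2 * y ^ 25 + 4 * y ^ 13 - 2 * y"
    by Groebner_Basis.algebra
  also have "\<dots> = 2 * (c + 2 * y ^ 13 - (2 * y ^ 5 + c)\<^sup>2 * D ^ 3)"
    unfolding D25 D13 unfolding D by Groebner_Basis.algebra
  finally show ?thesis .
qed

text \<open>
  In each of the three identities below, both the polynomial that is squared on the left and the
  difference on the right split into small factors modulo \<open>5\<close>. Since \<open>D\<^sup>2 - 1\<close> is, up to a
  constant, a product of two monic linear polynomials, including one of \<open>y \<plusminus> 1\<close>, the
  polynomial \<open>D\<^sup>2 (D\<^sup>2 - 1)\<^sup>5 - (D\<^sup>2 - 1) E\<^sup>2\<close> is divisible by the fifth power of that one; the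
  cofactor contains a difference of two squares modulo \<open>5\<close>, whose factorisation is \<open>Q\<close> up to
  a constant. The explicit polynomials multiplied by \<open>5\<close> are the integral
  differences between the two sides, divided by \<open>5\<close>.
\<close>

lemma norm_identity_1:
  fixes y :: "'r::idom"
  assumes five: "(5::'r) = 0" and D: "D = 2 * y + 1" and E: "E = y * (y\<^sup>2 - 1)\<^sup>2"
  shows "3 * (y - 1) ^ 12 * D * (D\<^sup>2 * (D\<^sup>2 - 1) ^ 5 - (D\<^sup>2 - 1) * E\<^sup>2)\<^sup>2 =
    E ^ 5 * (D * (D ^ 12 - 1)\<^sup>2 - 2 * (y * (y ^ 12 - 1)\<^sup>2))" (is "_ * ?P\<^sup>2 = _ * ?S")
proof -
  define Q where "Q = (y\<^sup>2 + 3 * y - 1) * (3 * y\<^sup>2 - y + 1)"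
  have "?P = 4 * y ^ 3 * (y + 1) ^ 5 * Q + 5 * (204 * y ^ 5 * (y + 1) ^ 5 * D\<^sup>2)"
    unfolding D E Q_def by Groebner_Basis.algebra
  then have P: "?P = 4 * y ^ 3 * (y + 1) ^ 5 * Q"
    by (rule eq_mod_5[OF five])
  have "?S = 2 * (1 + 2 * y ^ 13 - (2 * y ^ 5 + 1)\<^sup>2 * D ^ 3)"
    by (rule discriminant_difference_char_5[OF five _ D]) simp
  also have "\<dots> = 3 * y * (y - 1)\<^sup>2 * D * Q\<^sup>2
      + 5 * (- 3 * y - 17 * y ^ 3 + 18 * y ^ 4 + 5 * y ^ 5 - 108 * y ^ 6
       + 177 * y ^ 7 - 242 * y ^ 8 + 123 * y ^ 9 + 44 * y ^ 10 - 51 * y ^ 11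
       - 30 * y ^ 12 - 12 * y ^ 13)"
    unfolding D Q_def by Groebner_Basis.algebra
  finally have S: "?S = 3 * y * (y - 1)\<^sup>2 * D * Q\<^sup>2" by (rule eq_mod_5[OF five])
  define X where "X = y ^ 6 * (y - 1) ^ 12 * (y + 1) ^ 10 * D * Q\<^sup>2"
  have "3 * (y - 1) ^ 12 * D * ?P\<^sup>2 = 3 * X + 5 * (9 * X)"
    unfolding P X_def by (simp add: power_mult_distrib flip: power_mult)
  also have "3 * X = E ^ 5 * ?S"
  proof -
    have E': "E = y * (y - 1)\<^sup>2 * (y + 1)\<^sup>2" unfolding E by Groebner_Basis.algebra
    have "3 * (y ^ 6 * a ^ 12 * b ^ 10 * D * Q\<^sup>2) = (y * a\<^sup>2 * b\<^sup>2) ^ 5 * (3 * y * a\<^sup>2 * D * Q\<^sup>2)"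
      for a b :: 'r
      by Groebner_Basis.algebra
    then show ?thesis unfolding S X_def E' .
  qed
  finally show ?thesis by (rule eq_mod_5[OF five])
qed

lemma norm_identity_4:
  fixes y :: "'r::idom"
  assumes five: "(5::'r) = 0" and D: "D = 2 * y + 4" and E: "E = y * (y\<^sup>2 - 1)\<^sup>2"
  shows "2 * (y + 1) ^ 12 * D * (D\<^sup>2 * (D\<^sup>2 - 1) ^ 5 - (D\<^sup>2 - 1) * E\<^sup>2)\<^sup>2 =
    E ^ 5 * (D * (D ^ 12 - 1)\<^sup>2 - 2 * (y * (y ^ 12 - 1)\<^sup>2))" (is "_ * ?P\<^sup>2 = _ * ?S")
proof -
  define Q where "Q = (y\<^sup>2 - 3 * y - 1) * (3 * y\<^sup>2 + y + 1)"
  \<comment> \<open>with the representative \<open>- 1\<close> of the constant term, \<open>D\<^sup>2 - 1 = 4 y (y - 1)\<close> over the integers\<close>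
  have "D = 2 * y + (- 1) + 5 * 1" unfolding D by simp
  then have D': "D = 2 * y + (- 1)" by (rule eq_mod_5[OF five])
  have "?P = 4 * y ^ 3 * (y - 1) ^ 5 * Q + 5 * (204 * y ^ 5 * (y - 1) ^ 5 * D\<^sup>2)"
    unfolding D' E Q_def by Groebner_Basis.algebra
  then have P: "?P = 4 * y ^ 3 * (y - 1) ^ 5 * Q"
    by (rule eq_mod_5[OF five])
  have "?S = 2 * (- 1 + 2 * y ^ 13 - (2 * y ^ 5 + - 1)\<^sup>2 * D ^ 3)"
    by (rule discriminant_difference_char_5[OF five _ D']) simp
  also have "\<dots> = 2 * y * (y + 1)\<^sup>2 * D * Q\<^sup>2
      + 5 * (- 2 * y + 8 * y ^ 2 + 6 * y ^ 3 + 12 * y ^ 4 - 6 * y ^ 5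
       - 56 * y ^ 6 - 150 * y ^ 7 - 140 * y ^ 8 - 82 * y ^ 9 + 32 * y ^ 10
       + 18 * y ^ 11 + 12 * y ^ 12 - 12 * y ^ 13)"
    unfolding D' Q_def by Groebner_Basis.algebra
  finally have S: "?S = 2 * y * (y + 1)\<^sup>2 * D * Q\<^sup>2" by (rule eq_mod_5[OF five])
  define X where "X = y ^ 6 * (y + 1) ^ 12 * (y - 1) ^ 10 * D * Q\<^sup>2"
  have "2 * (y + 1) ^ 12 * D * ?P\<^sup>2 = 2 * X + 5 * (6 * X)"
    unfolding P X_def by (simp add: power_mult_distrib flip: power_mult)
  also have "2 * X = E ^ 5 * ?S"
  proof -
    have E': "E = y * (y - 1)\<^sup>2 * (y + 1)\<^sup>2" unfolding E by Groebner_Basis.algebra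
    have "2 * (y ^ 6 * b ^ 12 * a ^ 10 * D * Q\<^sup>2) = (y * a\<^sup>2 * b\<^sup>2) ^ 5 * (2 * y * b\<^sup>2 * D * Q\<^sup>2)"
      for a b :: 'r
      by Groebner_Basis.algebra
    then show ?thesis unfolding S X_def E' .
  qed
  finally show ?thesis by (rule eq_mod_5[OF five])
qed

lemma norm_identity_3:
  fixes y :: "'r::idom"
  assumes five: "(5::'r) = 0" and D: "D = 2 * y + 3" and E: "E = y * (y\<^sup>2 - 1)\<^sup>2"
  shows "4 * y ^ 6 * (y - 1) ^ 6 * D * (D\<^sup>2 * (D\<^sup>2 - 1) ^ 5 - (D\<^sup>2 - 1) * E\<^sup>2)\<^sup>2 =
    E ^ 5 * (D * (D ^ 12 - 1)\<^sup>2 - 2 * (y * (y ^ 12 - 1)\<^sup>2))" (is "_ * ?P\<^sup>2 = _ * ?S")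
proof -
  define Q where "Q = (y + 1) * (y + 3) * (y\<^sup>2 - y + 1)"
  \<comment> \<open>the representative \<open>- 2\<close> of the constant term shows the factor \<open>D = 2 (y - 1)\<close>\<close>
  have "D = 2 * y + (- 2) + 5 * 1" unfolding D by simp
  then have D': "D = 2 * y + (- 2)" by (rule eq_mod_5[OF five])
  have "D\<^sup>2 - 1 = 4 * (y + 1) * (y + 2) + 5 * (- 4 * y - 1)"
    unfolding D' by Groebner_Basis.algebra
  then have U: "D\<^sup>2 - 1 = 4 * (y + 1) * (y + 2)" by (rule eq_mod_5[OF five])
  have "1024 * (y + 2) ^ 4 - y\<^sup>2 * (y - 1)\<^sup>2 = 3 * Q + 5 * (3275 + 6553 * y + 4915 * y ^ 2 + 1637 * y ^ 3 + 204 * y ^ 4)"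
    unfolding Q_def by Groebner_Basis.algebra
  then have B: "1024 * (y + 2) ^ 4 - y\<^sup>2 * (y - 1)\<^sup>2 = 3 * Q" by (rule eq_mod_5[OF five])
  have "?P = 4 * (y + 1) ^ 5 * (y + 2) * (y - 1)\<^sup>2 * (1024 * (y + 2) ^ 4 - y\<^sup>2 * (y - 1)\<^sup>2)"
    unfolding U unfolding D' E by Groebner_Basis.algebra
  also have "\<dots> = 2 * (y + 1) ^ 5 * (y + 2) * (y - 1)\<^sup>2 * Q
      + 5 * (2 * (y + 1) ^ 5 * (y + 2) * (y - 1)\<^sup>2 * Q)"
    unfolding B by Groebner_Basis.algebra
  finally have P: "?P = 2 * (y + 1) ^ 5 * (y + 2) * (y - 1)\<^sup>2 * Q"
    by (rule eq_mod_5[OF five])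
  have "(- 2) ^ 5 = - 2 + 5 * (- 6 :: 'r)" by simp
  then have "(- 2) ^ 5 = (- 2 :: 'r)" by (rule eq_mod_5[OF five])
  then have "?S = 2 * (- 2 + 2 * y ^ 13 - (2 * y ^ 5 + - 2)\<^sup>2 * D ^ 3)"
    by (rule discriminant_difference_char_5[OF five _ D'])
  also have "\<dots> = 2 * y * (y - 1) * (y + 2)\<^sup>2 * Q\<^sup>2
      + 5 * (12 - 24 * y + 48 * y ^ 2 - 22 * y ^ 3 + 18 * y ^ 4
       - 10 * y ^ 5 + 58 * y ^ 6 - 84 * y ^ 7 + 28 * y ^ 8 - 10 * y ^ 9
       + 2 * y ^ 10 - 42 * y ^ 11 + 38 * y ^ 12 - 12 * y ^ 13)"
    unfolding D' Q_def by Groebner_Basis.algebra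
  finally have S: "?S = 2 * y * (y - 1) * (y + 2)\<^sup>2 * Q\<^sup>2" by (rule eq_mod_5[OF five])
  define X where "X = y ^ 6 * (y - 1) ^ 11 * (y + 1) ^ 10 * (y + 2)\<^sup>2 * Q\<^sup>2"
  have "4 * y ^ 6 * a ^ 6 * (2 * a) * (2 * b ^ 5 * c * a\<^sup>2 * Q)\<^sup>2 =
      2 * (y ^ 6 * a ^ 11 * b ^ 10 * c\<^sup>2 * Q\<^sup>2) + 5 * (6 * (y ^ 6 * a ^ 11 * b ^ 10 * c\<^sup>2 * Q\<^sup>2))"
    for a b c :: 'r
    by Groebner_Basis.algebra
  moreover have "D = 2 * (y - 1)" unfolding D' by simp
  ultimately have "4 * y ^ 6 * (y - 1) ^ 6 * D * ?P\<^sup>2 = 2 * X + 5 * (6 * X)"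
    unfolding P X_def by metis
  also have "2 * X = E ^ 5 * ?S"
  proof -
    have E': "E = y * (y - 1)\<^sup>2 * (y + 1)\<^sup>2" unfolding E by Groebner_Basis.algebra
    have "2 * (y ^ 6 * a ^ 11 * b ^ 10 * c\<^sup>2 * Q\<^sup>2) = (y * a\<^sup>2 * b\<^sup>2) ^ 5 * (2 * y * a * c\<^sup>2 * Q\<^sup>2)"
      for a b c :: 'r
      by Groebner_Basis.algebra
    then show ?thesis unfolding S X_def E' .
  qed
  finally show ?thesis by (rule eq_mod_5[OF five])
qed

section \<open>The three discriminants\<close>

text \<open>
  The hypotheses of the previous formula in terms of \<open>y = T\<^sup>2\<close>: here \<open>E = (T\<^sup>5 - T)\<^sup>2\<close> and
  \<open>y (y ^ 12 - 1)\<^sup>2 = (T ^ 25 - T)\<^sup>2\<close>. The denominator in the formula for \<open>j\<close> is nonzero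
  because it takes the value \<open>D\<^sup>2 (D\<^sup>2 - 1)\<^sup>5\<close> at a point \<open>x\<close> where \<open>T\<^sup>5 - T\<close> vanishes.
\<close>

lemma norm_of_singular_modulus_in_square:
  fixes \<iota> :: "'a::{finite,field} fls \<Rightarrow> 'c::{field,complete_space}"
  assumes hom: "field_hom \<iota>" and q: "CARD('a) = 5"
    and c: "c ^ 5 = (c :: 'a)" "c \<noteq> 0" and D: "D = 2 * poly_T\<^sup>2 + [:c:]"
    and x: "x ^ 5 = x" "poly D x \<noteq> 0" "(poly D x)\<^sup>2 \<noteq> 1"
    and y: "y = poly_T\<^sup>2" and E: "E = y * (y\<^sup>2 - 1)\<^sup>2"
    and N: "N * D * (D\<^sup>2 * (D\<^sup>2 - 1) ^ 5 - (D\<^sup>2 - 1) * E\<^sup>2)\<^sup>2 =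
      E ^ 5 * (D * (D ^ 12 - 1)\<^sup>2 - 2 * (y * (y ^ 12 - 1)\<^sup>2))"
    and j: "singular_modulus_with_discriminant \<iota> D j"
  shows "norm_over_k \<iota> j = emb_A \<iota> N"
proof (rule norm_of_singular_modulus[OF hom q c D refl refl refl _ _ j])
  define t where "t = (poly_T :: 'a poly)"
  have E': "E = (t ^ 5 - t)\<^sup>2"
    unfolding E y t_def[symmetric] by Groebner_Basis.algebra
  have F: "y * (y ^ 12 - 1)\<^sup>2 = (t ^ 25 - t)\<^sup>2"
    unfolding y t_def[symmetric] by Groebner_Basis.algebra
  have E2: "E\<^sup>2 = (t ^ 5 - t) ^ 4" and E5: "E ^ 5 = (t ^ 5 - t) ^ 10"
    unfolding E' by (simp_all flip: power_mult)
  show "N * D * (D\<^sup>2 * (D\<^sup>2 - 1) ^ 5 - (D\<^sup>2 - 1) * (poly_T ^ 5 - poly_T) ^ 4)\<^sup>2 =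
      (poly_T ^ 5 - poly_T) ^ 10 * (D * (D ^ 12 - 1)\<^sup>2 - 2 * (poly_T ^ 25 - poly_T)\<^sup>2)"
    using N unfolding E2 E5 F t_def .
  have "poly (D\<^sup>2 * (D\<^sup>2 - 1) ^ 5 - (D\<^sup>2 - 1) * (poly_T ^ 5 - poly_T) ^ 4) x \<noteq> 0"
    using x by simp
  then show "D\<^sup>2 * (D\<^sup>2 - 1) ^ 5 - (D\<^sup>2 - 1) * (poly_T ^ 5 - poly_T) ^ 4 \<noteq> 0" by (metis poly_0)
qed

theorem proposition6:
  fixes \<iota> :: "'a::{finite,field} fls \<Rightarrow> 'c::{field,complete_space}"
  assumes "CARD('a) = 5"
    and "completed_algebraic_closure \<iota>"
  shows
    "(\<forall>j. singular_modulus_with_discriminant \<iota> (2 * poly_T ^ 2 + 1) j \<longrightarrow>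
        norm_over_k \<iota> j = emb_A \<iota> (3 * (poly_T + 1) ^ 12 * (poly_T + 4) ^ 12)) \<and>
     (\<forall>j. singular_modulus_with_discriminant \<iota> (2 * poly_T ^ 2 + 3) j \<longrightarrow>
        norm_over_k \<iota> j = emb_A \<iota> (4 * poly_T ^ 12 * (poly_T + 1) ^ 6 * (poly_T + 4) ^ 6)) \<and>
     (\<forall>j. singular_modulus_with_discriminant \<iota> (2 * poly_T ^ 2 + 4) j \<longrightarrow>
        norm_over_k \<iota> j = emb_A \<iota> (2 * (poly_T + 2) ^ 12 * (poly_T + 3) ^ 12)) \<and>
     (\<forall>D \<in> {2 * poly_T ^ 2 + 1, 2 * poly_T ^ 2 + 3, 2 * poly_T ^ 2 + 4}.
        \<forall>j. singular_modulus_with_discriminant \<iota> D j \<longrightarrow>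
          (\<exists>N. norm_over_k \<iota> j = emb_A \<iota> N \<and> lead_coeff N \<noteq> 1))"
proof -
  note q = \<open>CARD('a) = 5\<close>
  have hom: "field_hom \<iota>"
    using assms(2) by (simp add: completed_algebraic_closure_def)
  have five: "(5::'a) = 0" using of_nat_CARD_eq_0[where 'a = 'a] q by simp
  then have five': "(5::'a poly) = 0" by (simp add: numeral_poly)
  \<comment> \<open>the residues needed for the constant terms, the values of \<open>D\<close> and the fifth powers\<close>
  have mod_5: "(9::'a) = 4" "(144::'a) = 4" "(32::'a) = 2" "(243::'a) = 3" "(1024::'a) = 4" "(12::'a) = 2"
    using eq_mod_5[OF five, of 9 4 1] eq_mod_5[OF five, of 144 4 28] eq_mod_5[OF five, of 32 2 6]
      eq_mod_5[OF five, of 243 3 48] eq_mod_5[OF five, of 1024 4 204] eq_mod_5[OF five, of 12 2 2]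
    by simp_all
  have two: "(2::'a) \<noteq> 0" and three: "(3::'a) \<noteq> 0"
  proof -
    have "2 * 3 = (1::'a) + 5 * 1" by simp
    then have "2 * 3 = (1::'a)" by (rule eq_mod_5[OF five])
    then show "(2::'a) \<noteq> 0" "(3::'a) \<noteq> 0" by force+
  qed
  have four: "2 * 2 \<noteq> (0::'a)" using two by (simp only: mult_eq_0_iff) simp
  have distinct: "(2::'a) \<noteq> 1" "(3::'a) \<noteq> 1" "(4::'a) \<noteq> 1"
  proof -
    have "(2::'a) - 1 = 1" "(3::'a) - 1 = 2" "(4::'a) - 1 = 3" by simp_all
    then show "(2::'a) \<noteq> 1" "(3::'a) \<noteq> 1" "(4::'a) \<noteq> 1" using two three by force+
  qed
  define y where "y = (poly_T\<^sup>2 :: 'a poly)"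
  define E where "E = y * (y\<^sup>2 - 1)\<^sup>2"
  note norm = norm_of_singular_modulus_in_square[OF hom q _ _ _ _ _ _ y_def E_def]
  have "(t + 1) * (t + 4) = t\<^sup>2 - 1 + 5 * (t + 1)" "(t + 2) * (t + 3) = t\<^sup>2 + 1 + 5 * (t + 1)"
    for t :: "'a poly"
    by Groebner_Basis.algebra+
  then have y_factors: "(poly_T + 1) * (poly_T + 4) = y - 1" "(poly_T + 2) * (poly_T + 3) = y + 1"
    unfolding y_def by (metis eq_mod_5[OF five'])+
  \<comment> \<open>the points \<open>1\<close>, \<open>0\<close>, \<open>2\<close> are chosen such that \<open>D\<close> has the value \<open>3\<close>, \<open>3\<close>, \<open>2\<close> there, whose square is \<open>4\<close>\<close>
  have 1: "norm_over_k \<iota> j = emb_A \<iota> (3 * (poly_T + 1) ^ 12 * (poly_T + 4) ^ 12)"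
    if "singular_modulus_with_discriminant \<iota> (2 * poly_T ^ 2 + 1) j" for j
  proof (rule norm[where c = 1 and x = 1, OF _ _ _ _ _ _ _ that])
    have "3 * (poly_T + 1) ^ 12 * (poly_T + 4) ^ 12 = 3 * (y - 1) ^ 12"
      unfolding y_factors[symmetric] by (simp add: power_mult_distrib)
    then show "3 * (poly_T + 1) ^ 12 * (poly_T + 4) ^ 12 * (2 * poly_T ^ 2 + 1) *
        ((2 * poly_T ^ 2 + 1)\<^sup>2 * ((2 * poly_T ^ 2 + 1)\<^sup>2 - 1) ^ 5
          - ((2 * poly_T ^ 2 + 1)\<^sup>2 - 1) * E\<^sup>2)\<^sup>2 =
        E ^ 5 * ((2 * poly_T ^ 2 + 1) * ((2 * poly_T ^ 2 + 1) ^ 12 - 1)\<^sup>2 - 2 * (y * (y ^ 12 - 1)\<^sup>2))"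
      using norm_identity_1[OF five' _ E_def] by (simp only: y_def)
    show "(poly (2 * poly_T\<^sup>2 + 1) (1::'a))\<^sup>2 \<noteq> 1" using distinct mod_5 by simp
  qed (use three in \<open>simp_all add: one_pCons\<close>)
  have 2: "norm_over_k \<iota> j = emb_A \<iota> (4 * poly_T ^ 12 * (poly_T + 1) ^ 6 * (poly_T + 4) ^ 6)"
    if "singular_modulus_with_discriminant \<iota> (2 * poly_T ^ 2 + 3) j" for j
  proof (rule norm[where c = 3 and x = 0, OF _ _ _ _ _ _ _ that])
    have "4 * poly_T ^ 12 * (poly_T + 1) ^ 6 * (poly_T + 4) ^ 6 = 4 * y ^ 6 * (y - 1) ^ 6"
      unfolding y_factors[symmetric] by (simp add: power_mult_distrib y_def flip: power_mult)
    then show "4 * poly_T ^ 12 * (poly_T + 1) ^ 6 * (poly_T + 4) ^ 6 * (2 * poly_T ^ 2 + 3) *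
        ((2 * poly_T ^ 2 + 3)\<^sup>2 * ((2 * poly_T ^ 2 + 3)\<^sup>2 - 1) ^ 5
          - ((2 * poly_T ^ 2 + 3)\<^sup>2 - 1) * E\<^sup>2)\<^sup>2 =
        E ^ 5 * ((2 * poly_T ^ 2 + 3) * ((2 * poly_T ^ 2 + 3) ^ 12 - 1)\<^sup>2 - 2 * (y * (y ^ 12 - 1)\<^sup>2))"
      using norm_identity_3[OF five' _ E_def] by (simp only: y_def)
    show "(poly (2 * poly_T\<^sup>2 + 3) (0::'a))\<^sup>2 \<noteq> 1" using distinct mod_5 by simp
  qed (use three mod_5 in \<open>simp_all add: numeral_poly\<close>)
  have 3: "norm_over_k \<iota> j = emb_A \<iota> (2 * (poly_T + 2) ^ 12 * (poly_T + 3) ^ 12)"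
    if "singular_modulus_with_discriminant \<iota> (2 * poly_T ^ 2 + 4) j" for j
  proof (rule norm[where c = 4 and x = 2, OF _ _ _ _ _ _ _ that])
    have "2 * (poly_T + 2) ^ 12 * (poly_T + 3) ^ 12 = 2 * (y + 1) ^ 12"
      unfolding y_factors[symmetric] by (simp add: power_mult_distrib)
    then show "2 * (poly_T + 2) ^ 12 * (poly_T + 3) ^ 12 * (2 * poly_T ^ 2 + 4) *
        ((2 * poly_T ^ 2 + 4)\<^sup>2 * ((2 * poly_T ^ 2 + 4)\<^sup>2 - 1) ^ 5
          - ((2 * poly_T ^ 2 + 4)\<^sup>2 - 1) * E\<^sup>2)\<^sup>2 =
        E ^ 5 * ((2 * poly_T ^ 2 + 4) * ((2 * poly_T ^ 2 + 4) ^ 12 - 1)\<^sup>2 - 2 * (y * (y ^ 12 - 1)\<^sup>2))"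
      using norm_identity_4[OF five' _ E_def] by (simp only: y_def)
    show "(poly (2 * poly_T\<^sup>2 + 4) (2::'a))\<^sup>2 \<noteq> 1" using distinct mod_5 by simp
  qed (use two four mod_5 in \<open>simp_all add: numeral_poly\<close>)
  have lead: "lead_coeff (3 * (poly_T + 1) ^ 12 * (poly_T + 4) ^ 12 :: 'a poly) = 3"
    "lead_coeff (4 * poly_T ^ 12 * (poly_T + 1) ^ 6 * (poly_T + 4) ^ 6 :: 'a poly) = 4"
    "lead_coeff (2 * (poly_T + 2) ^ 12 * (poly_T + 3) ^ 12 :: 'a poly) = 2"
    by (simp_all add: lead_coeff_mult lead_coeff_power numeral_poly one_pCons)
  from 1 2 3 lead distinct show ?thesis by (intro conjI) (simp, simp, simp, metis insertE singletonD)
qed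

end
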